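(* Let $\mathcal{A}\subseteq\{1,2,\ldots,n-1\}$, let $w\in S_n$, and suppose that the Peterson Schubert class $p_w\in H^*_{S^1}(Y)$ satisfies $$p_w(w_{\mathcal{B}})=0\quad\text{for all } \mathcal{B}\subseteq\{1,\ldots,n-1\}\text{ with } w_{\mathcal{B}}\not\geq w_{\mathcal{A}},$$ and $p_w(w_{\mathcal{A}})\neq 0$. Then $p_{v_{\mathcal{A}}}(w_{\mathcal{A}})$ divides $p_w(w_{\mathcal{A}})$ in $H^*_{S^1}(\mathrm{pt})\cong\mathbb{C}[t]$.
   Context: Fix a positive integer $n$. $G=GL(n,\mathbb{C})$, $B\subset G$ is the subgroup of upper-triangular matrices, $T$ is the group of unitary diagonal matrices, acting on $G/B\cong\{V_\bullet=(V_1\subseteq\cdots\subseteq V_{n-1}\subseteq V_n=\mathbb{C}^n):\dim V_i=i\}$ by left multiplication. Let $X=\sum_{i=1}^{n-1}E_{i,i+1}$. The Peterson variety of type $A_{n-1}$ is $Y=\{V_\bullet : XV_i\subseteq V_{i+1}\text{ for }1\le i\le n-1\}\subseteq G/B$, with the action of $S^1=\{\mathrm{diag}(\tau^n,\tau^{n-1},\ldots,\tau):\tau\in\mathbb{C},|\tau|=1\}\subseteq T$, which preserves $Y$. Equivariant cohomology is Borel-equivariant cohomology with $\mathbb{C}$ coefficients; $H^*_T(\mathrm{pt})\cong\mathbb{C}[t_1,\ldots,t_n]$ and $H^*_{S^1}(\mathrm{pt})\cong\mathbb{C}[t]$. The permutation matrix of $w\in S_n$ satisfies $we_i=e_{w(i)}$;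 $(G/B)^T=\{wB:w\in S_n\}$ is identified with $S_n$. $s_i$ is the transposition of $i,i+1$, $\ell$ is length, and $\leq$ is Bruhat order on $S_n$. $\sigma_w\in H^*_T(G/B)$ is the $T$-equivariant Schubert class of $w$, and $\sigma_v(w)\in\mathbb{C}[t_1,\ldots,t_n]$ is its restriction to $wB$; it is normalized so that, for any reduced word $w=s_{b_1}\cdots s_{b_{\ell(w)}}$, $\sigma_v(w)=\sum\prod_{j=1}^{\ell(v)} s_{b_1}\cdots s_{b_{i_j-1}}(t_{b_{i_j}}-t_{b_{i_j}+1})$, summed over $i_1<\cdots<i_{\ell(v)}$ with $s_{b_{i_1}}\cdots s_{b_{i_{\ell(v)}}}=v$ (permutations act on the indices of the $t_k$). The Peterson Schubert class $p_w\in H^*_{S^1}(Y)$ is the image of $\sigma_w$ under the natural maps $H^*_T(G/B)\to H^*_{S^1}(G/B)\to H^*_{S^1}(Y)$. For $\mathcal{A}\subseteq\{1,\ldots,n-1\}$, $w_{\mathcal{A}}\in S_n$ is the longest element of the subgroup generated by $\{s_i:i\in\mathcal{A}\}$, and $v_{\mathcal{A}}\in S_n$ is the product of the $s_j$, $j\in\mathcal{A}$, in increasing order of index. The $S^1$-fixed points of $Y$ are exactly the $w_{\mathcal{A}}B$, and $p_w(w_{\mathcal{A}})\in\mathbb{C}[t]$ denotes the restriction of $p_w$ to $w_{\mathcal{A}}B$. *)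

theory Defs
  imports
    "HOL-Homology.Simplices"
    "HOL-Algebra.QuotRing"
    "HOL-Algebra.Sym_Groups"
    "HOL-Algebra.Generated_Groups"
    "HOL-Computational_Algebra.Polynomial"
    "Jordan_Normal_Form.Matrix"
begin

section \<open>Singular cohomology with complex coefficients\<close>

text \<open>A cochain is a finitely supported family of functions on singular simplices, indexed by
  the dimension, so that the total complex is the direct sum (not the product) of its degrees.\<close>

type_synonym 'a cochain = "nat \<Rightarrow> ((nat \<Rightarrow> real) \<Rightarrow> 'a) \<Rightarrow> complex"

definition cochains :: "'a topology \<Rightarrow> 'a cochain set" where
  "cochains X = {f. (\<forall>p s. \<not> singular_simplex p X s \<longrightarrow> f p s = 0) \<and>
                    (\<exists>N. \<forall>p\<ge>N. \<forall>s. f p s = 0)}"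

definition coboundary :: "'a topology \<Rightarrow> 'a cochain \<Rightarrow> 'a cochain" where
  "coboundary X f = (\<lambda>p s. if 0 < p \<and> singular_simplex p X s
     then (\<Sum>k\<le>p. (-1) ^ k * f (p - 1) (singular_face p k s)) else 0)"

text \<open>The front \<open>i\<close>-face and the back \<open>j\<close>-face of a singular \<open>(i + j)\<close>-simplex; a point of
  \<^term>\<open>standard_simplex p\<close> is a sequence that vanishes beyond position \<open>p\<close>.\<close>

definition front_face :: "nat \<Rightarrow> ((nat \<Rightarrow> real) \<Rightarrow> 'a) \<Rightarrow> (nat \<Rightarrow> real) \<Rightarrow> 'a" where
  "front_face i s = restrict s (standard_simplex i)"

definition back_face :: "nat \<Rightarrow> nat \<Rightarrow> ((nat \<Rightarrow> real) \<Rightarrow> 'a) \<Rightarrow> (nat \<Rightarrow> real) \<Rightarrow> 'a" where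
  "back_face i j s = restrict (\<lambda>x. s (\<lambda>k. if k < i then 0 else x (k - i))) (standard_simplex j)"

definition cup :: "'a topology \<Rightarrow> 'a cochain \<Rightarrow> 'a cochain \<Rightarrow> 'a cochain" where
  "cup X f g = (\<lambda>p s. if singular_simplex p X s
     then (\<Sum>i\<le>p. f i (front_face i s) * g (p - i) (back_face i (p - i) s)) else 0)"

definition const_cochain :: "'a topology \<Rightarrow> complex \<Rightarrow> 'a cochain" where
  "const_cochain X a = (\<lambda>p s. if p = 0 \<and> singular_simplex 0 X s then a else 0)"

definition cocycle_ring :: "'a topology \<Rightarrow> 'a cochain ring" where
  "cocycle_ring X =
     \<lparr>carrier = {f \<in> cochains X. coboundary X f = (\<lambda>p s. 0)},
      monoid.mult = cup X,
      one = const_cochain X 1,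
      zero = (\<lambda>p s. 0),
      add = (\<lambda>f g p s. f p s + g p s)\<rparr>"

definition coboundaries :: "'a topology \<Rightarrow> 'a cochain set" where
  "coboundaries X = coboundary X ` cochains X"

definition cohomology :: "'a topology \<Rightarrow> 'a cochain set ring" where
  "cohomology X = cocycle_ring X Quot coboundaries X"

definition const_class :: "'a topology \<Rightarrow> complex \<Rightarrow> 'a cochain set" where
  "const_class X a = coboundaries X +>\<^bsub>cocycle_ring X\<^esub> const_cochain X a"

definition has_degree :: "nat \<Rightarrow> 'a cochain set \<Rightarrow> bool" where
  "has_degree d C \<longleftrightarrow> (\<exists>f\<in>C. \<forall>p s. p \<noteq> d \<longrightarrow> f p s = 0)"

definition pullback_cochain ::
    "'a topology \<Rightarrow> ('a \<Rightarrow> 'b) \<Rightarrow> 'b cochain \<Rightarrow> 'a cochain" where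
  "pullback_cochain X F f =
     (\<lambda>p s. if singular_simplex p X s then f p (simplex_map p F s) else 0)"

text \<open>The map that a continuous \<open>F\<close> from \<open>X\<close> induces on cohomology classes, which are cosets of
  cochains.\<close>

definition pullback :: "'a topology \<Rightarrow> ('a \<Rightarrow> 'b) \<Rightarrow> 'b cochain set \<Rightarrow> 'a cochain set" where
  "pullback X F C = (\<Union>f\<in>C. coboundaries X +>\<^bsub>cocycle_ring X\<^esub> pullback_cochain X F f)"


section \<open>Borel-equivariant cohomology for subgroups of the diagonal torus\<close>

definition quotient_topology :: "'a topology \<Rightarrow> ('a \<Rightarrow> 'b) \<Rightarrow> 'b topology" where
  "quotient_topology X q =
     topology (\<lambda>U. U \<subseteq> q ` topspace X \<and> openin X {x \<in> topspace X. q x \<in> U})"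

lemma openin_quotient_topology:
  "openin (quotient_topology X q) U \<longleftrightarrow>
     U \<subseteq> q ` topspace X \<and> openin X {x \<in> topspace X. q x \<in> U}"
proof -
  let ?L = "\<lambda>U. U \<subseteq> q ` topspace X \<and> openin X {x \<in> topspace X. q x \<in> U}"
  have "istopology ?L"
    unfolding istopology_def
  proof (intro conjI allI impI)
    fix S T assume S: "?L S" and T: "?L T"
    have "{x \<in> topspace X. q x \<in> S \<inter> T} =
        {x \<in> topspace X. q x \<in> S} \<inter> {x \<in> topspace X. q x \<in> T}" by blast
    with S T show "openin X {x \<in> topspace X. q x \<in> S \<inter> T}" by auto
    show "S \<inter> T \<subseteq> q ` topspace X" using S by blast
  next
    fix \<K> assume K: "\<forall>K\<in>\<K>. ?L K"
    have "{x \<in> topspace X. q x \<in> \<Union>\<K>} = (\<Union>K\<in>\<K>. {x \<in> topspace X. q x \<in> K})" by blast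
    with K show "openin X {x \<in> topspace X. q x \<in> \<Union>\<K>}" by auto
    show "\<Union>\<K> \<subseteq> q ` topspace X" using K by blast
  qed
  then show ?thesis
    unfolding quotient_topology_def by (simp add: topology_inverse')
qed

lemma quotient_map_quotient_topology: "quotient_map X (quotient_topology X q) q"
proof -
  have "topspace (quotient_topology X q) = q ` topspace X"
    unfolding topspace_def openin_quotient_topology
    by (auto intro!: exI[of _ "q ` topspace X"] simp flip: topspace_def)
       (metis (mono_tags, lifting) Collect_cong Collect_mem_eq imageI openin_topspace)
  then show ?thesis
    by (auto simp: quotient_map_def openin_quotient_topology)
qed

definition torus :: "nat \<Rightarrow> complex mat set" where
  "torus n = {mat_diag n d |d. \<forall>i<n. cmod (d i) = 1}"

text \<open>Rows and columns of matrices are numbered from \<open>0\<close>, so the entries below are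
  \<open>\<tau>\<^sup>n, \<dots>, \<tau>\<close>.\<close>

definition circle :: "nat \<Rightarrow> complex mat set" where
  "circle n = {mat_diag n (\<lambda>i. \<tau> ^ (n - i)) |\<tau>. cmod \<tau> = 1}"

text \<open>A contractible space on which the torus acts freely: the \<open>n\<close>-fold power of the nonzero
  complex sequences, with the product topology. The map sending \<open>x\<close> to
  \<open>(1 - s) x + s (shift x)\<close>, followed by a straight line to a unit vector, contracts each
  factor. Since a closed subgroup of the torus also acts freely, the same space is used for the
  circle, and restriction of the group is induced by a projection between orbit spaces.\<close>

type_synonym total = "nat \<Rightarrow> nat \<Rightarrow> complex"

definition ET :: "nat \<Rightarrow> total topology" where
  "ET n = top_of_set {e. (\<forall>i<n. e i \<noteq> (\<lambda>m. 0)) \<and> (\<forall>i\<ge>n. e i = (\<lambda>m. 0))}"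

definition ET_act :: "complex mat \<Rightarrow> total \<Rightarrow> total" where
  "ET_act k e = (\<lambda>i m. if i < dim_row k then k $$ (i, i) * e i m else 0)"

definition borel_orbit ::
    "complex mat set \<Rightarrow> (complex mat \<Rightarrow> 'a \<Rightarrow> 'a) \<Rightarrow> total \<times> 'a \<Rightarrow> (total \<times> 'a) set" where
  "borel_orbit K act = (\<lambda>(e, x). {(ET_act k e, act k x) |k. k \<in> K})"

definition borel_space ::
    "nat \<Rightarrow> complex mat set \<Rightarrow> (complex mat \<Rightarrow> 'a \<Rightarrow> 'a) \<Rightarrow> 'a topology \<Rightarrow>
     (total \<times> 'a) set topology" where
  "borel_space n K act X = quotient_topology (prod_topology (ET n) X) (borel_orbit K act)"

text \<open>The map of Borel spaces induced by an equivariant map \<open>F\<close> into a space with an action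
  \<open>act'\<close> of a group \<open>K'\<close> containing the given group.\<close>

definition borel_map ::
    "complex mat set \<Rightarrow> (complex mat \<Rightarrow> 'b \<Rightarrow> 'b) \<Rightarrow> ('a \<Rightarrow> 'b) \<Rightarrow>
     (total \<times> 'a) set \<Rightarrow> (total \<times> 'b) set" where
  "borel_map K' act' F Q = (\<Union>(e, x)\<in>Q. borel_orbit K' act' (e, F x))"

abbreviation B_pt :: "nat \<Rightarrow> complex mat set \<Rightarrow> (total \<times> unit) set topology" where
  "B_pt n K \<equiv> borel_space n K (\<lambda>k x. x) (discrete_topology {()})"

abbreviation H_pt :: "nat \<Rightarrow> complex mat set \<Rightarrow> (total \<times> unit) set cochain set ring" where
  "H_pt n K \<equiv> cohomology (B_pt n K)"

text \<open>The first Chern class, in the degree 2 cohomology of \<open>BK = ET/K\<close>, of the line bundle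
  \<open>ET \<times>\<^sub>K \<complex>\<close> attached to a character \<open>\<psi>\<close> of a subtorus \<open>K\<close>. It is the transgression of \<open>\<psi>\<close>:
  the pullback of a representing cocycle to \<open>ET\<close> is the coboundary of a 1-cochain \<open>b\<close> whose value
  on the loop swept out in an orbit by a one-parameter loop of \<open>K\<close> is the degree of \<open>\<psi>\<close> along
  that loop. With these signs the coordinate character of the circle gives the hyperplane
  class.\<close>

definition cocharacter :: "nat \<Rightarrow> (nat \<Rightarrow> int) \<Rightarrow> real \<Rightarrow> complex mat" where
  "cocharacter n a r = mat_diag n (\<lambda>i. cis (2 * pi * of_int (a i) * r))"

definition orbit_loop :: "nat \<Rightarrow> (nat \<Rightarrow> int) \<Rightarrow> total \<Rightarrow> (nat \<Rightarrow> real) \<Rightarrow> total" where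
  "orbit_loop n a e = restrict (\<lambda>x. ET_act (cocharacter n a (x 1)) e) (standard_simplex 1)"

definition chern_class ::
    "nat \<Rightarrow> complex mat set \<Rightarrow> (complex mat \<Rightarrow> complex) \<Rightarrow> (total \<times> unit) set cochain set \<Rightarrow> bool" where
  "chern_class n K \<psi> C \<longleftrightarrow>
     C \<in> carrier (H_pt n K) \<and>
     (\<exists>c\<in>C. (\<forall>p s. p \<noteq> 2 \<longrightarrow> c p s = 0) \<and>
       (\<exists>b\<in>cochains (ET n).
          coboundary (ET n) b =
            pullback_cochain (ET n) (\<lambda>e. borel_orbit K (\<lambda>k x. x) (e, ())) c \<and>
          (\<forall>e\<in>topspace (ET n). \<forall>a d.
             (\<forall>r. cocharacter n a r \<in> K \<and>
                  \<psi> (cocharacter n a r) = cis (2 * pi * of_int d * r)) \<longrightarrow>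
             b 1 (orbit_loop n a e) = of_int d)))"

text \<open>An identification of \<open>H\<^sub>S\<^sub>1(pt)\<close> with \<open>\<complex>[t]\<close>, as \<open>\<complex>\<close>-algebras; \<open>t\<close> is the
  Chern class of the character \<open>\<tau>\<close> of the circle, its last diagonal entry.\<close>

definition poly_ring :: "complex poly ring" where
  "poly_ring = \<lparr>carrier = UNIV, monoid.mult = (*), one = 1, zero = 0, add = (+)\<rparr>"

definition circle_identification ::
    "nat \<Rightarrow> (complex poly \<Rightarrow> (total \<times> unit) set cochain set) \<Rightarrow> bool" where
  "circle_identification n \<iota> \<longleftrightarrow>
     \<iota> \<in> ring_iso poly_ring (H_pt n (circle n)) \<and>
     (\<forall>a. \<iota> [:a:] = const_class (B_pt n (circle n)) a) \<and>
     chern_class n (circle n) (\<lambda>k. k $$ (n - 1, n - 1)) (\<iota> [:0, 1:])"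


section \<open>The flag variety and the Peterson variety\<close>

definition GL :: "nat \<Rightarrow> complex mat set" where
  "GL n = {g \<in> carrier_mat n n. invertible_mat g}"

definition Borel :: "nat \<Rightarrow> complex mat set" where
  "Borel n = {b \<in> GL n. upper_triangular b}"

definition opposite_Borel :: "nat \<Rightarrow> complex mat set" where
  "opposite_Borel n = {b \<in> GL n. upper_triangular (transpose_mat b)}"

definition GL_topology :: "nat \<Rightarrow> complex mat topology" where
  "GL_topology n =
     pullback_topology (GL n) (\<lambda>g. restrict (\<lambda>(i, j). g $$ (i, j)) ({..<n} \<times> {..<n}))
       (product_topology (\<lambda>_. euclidean) ({..<n} \<times> {..<n}))"

definition mat_coset :: "nat \<Rightarrow> complex mat \<Rightarrow> complex mat set" where
  "mat_coset n g = (\<lambda>b. g * b) ` Borel n"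

definition flag_variety :: "nat \<Rightarrow> complex mat set topology" where
  "flag_variety n = quotient_topology (GL_topology n) (mat_coset n)"

definition left_act :: "complex mat \<Rightarrow> complex mat set \<Rightarrow> complex mat set" where
  "left_act k C = (\<lambda>g. k * g) ` C"

text \<open>The subspace \<open>V\<^sub>i\<close> of the flag of the coset \<open>C\<close>: the span of the first \<open>i\<close> columns of any
  matrix in \<open>C\<close>.\<close>

definition flag_space :: "nat \<Rightarrow> complex mat set \<Rightarrow> nat \<Rightarrow> complex vec set" where
  "flag_space n C i =
     {g *\<^sub>v c |g c. g \<in> C \<and> c \<in> carrier_vec n \<and> (\<forall>j\<in>{i..<n}. vec_index c j = 0)}"

definition nilpotent_X :: "nat \<Rightarrow> complex mat" where
  "nilpotent_X n = mat n n (\<lambda>(i, j). if j = Suc i then 1 else 0)"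

definition peterson_set :: "nat \<Rightarrow> complex mat set set" where
  "peterson_set n =
     {C \<in> topspace (flag_variety n). \<forall>i\<in>{1..n - 1}.
        (\<lambda>v. nilpotent_X n *\<^sub>v v) ` flag_space n C i \<subseteq> flag_space n C (i + 1)}"

definition peterson_variety :: "nat \<Rightarrow> complex mat set topology" where
  "peterson_variety n = subtopology (flag_variety n) (peterson_set n)"


section \<open>The symmetric group\<close>

text \<open>Permutations of \<open>{1..n}\<close>, as elements of \<^term>\<open>sym_group n\<close>.\<close>

definition simple_refl :: "nat \<Rightarrow> nat \<Rightarrow> nat" where
  "simple_refl i = Transposition.transpose i (Suc i)"

definition word_prod :: "nat list \<Rightarrow> nat \<Rightarrow> nat" where
  "word_prod bs = foldr (\<lambda>b u. simple_refl b \<circ> u) bs id"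

definition cox_length :: "nat \<Rightarrow> (nat \<Rightarrow> nat) \<Rightarrow> nat" where
  "cox_length n w = (LEAST k. \<exists>bs. set bs \<subseteq> {1..n - 1} \<and> length bs = k \<and> word_prod bs = w)"

definition reduced_word :: "nat \<Rightarrow> (nat \<Rightarrow> nat) \<Rightarrow> nat list \<Rightarrow> bool" where
  "reduced_word n w bs \<longleftrightarrow>
     set bs \<subseteq> {1..n - 1} \<and> word_prod bs = w \<and> length bs = cox_length n w"

definition bruhat_le :: "nat \<Rightarrow> (nat \<Rightarrow> nat) \<Rightarrow> (nat \<Rightarrow> nat) \<Rightarrow> bool" where
  "bruhat_le n = (\<lambda>u v. u permutes {1..n} \<and> (\<exists>i\<in>{1..n}. \<exists>j\<in>{1..n}.
       v = u \<circ> Transposition.transpose i j \<and> cox_length n u < cox_length n v))\<^sup>*\<^sup>*"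

definition w_long :: "nat \<Rightarrow> nat set \<Rightarrow> nat \<Rightarrow> nat" where
  "w_long n A = arg_max (cox_length n) (\<lambda>u. u \<in> generate (sym_group n) (simple_refl ` A))"

definition v_cox :: "nat set \<Rightarrow> nat \<Rightarrow> nat" where
  "v_cox A = word_prod (sorted_list_of_set A)"

definition perm_mat :: "nat \<Rightarrow> (nat \<Rightarrow> nat) \<Rightarrow> complex mat" where
  "perm_mat n w = mat n n (\<lambda>(i, j). if Suc i = w (Suc j) then 1 else 0)"

abbreviation fixed_point :: "nat \<Rightarrow> (nat \<Rightarrow> nat) \<Rightarrow> complex mat set" where
  "fixed_point n w \<equiv> mat_coset n (perm_mat n w)"


section \<open>Schubert classes and Peterson Schubert classes\<close>

type_synonym flag_class = "(total \<times> complex mat set) set cochain set"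
type_synonym pt_class = "(total \<times> unit) set cochain set"

text \<open>Restriction of a \<open>K\<close>-equivariant class on a \<open>K\<close>-invariant subspace of the flag variety to the
  fixed point \<open>wB\<close>.\<close>

definition localize :: "nat \<Rightarrow> complex mat set \<Rightarrow> flag_class \<Rightarrow> (nat \<Rightarrow> nat) \<Rightarrow> pt_class" where
  "localize n K C w = pullback (B_pt n K) (borel_map K left_act (\<lambda>_. fixed_point n w)) C"

text \<open>The formula normalizing \<open>\<sigma>\<^sub>v(w)\<close>, for a word \<open>bs\<close> of \<open>w\<close>, evaluated in the ring
  \<open>R = H\<^sub>T(pt)\<close>, where the variable with index \<open>k\<close> is the class \<open>t k\<close>. List positions are numbered
  from \<open>0\<close>.\<close>

definition root_factor ::
    "('r, 'm) ring_scheme \<Rightarrow> (nat \<Rightarrow> 'r) \<Rightarrow> nat list \<Rightarrow> nat \<Rightarrow> 'r" where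
  "root_factor R t bs i =
     t (word_prod (take i bs) (bs ! i)) \<ominus>\<^bsub>R\<^esub> t (word_prod (take i bs) (bs ! i + 1))"

definition billey_sum ::
    "nat \<Rightarrow> ('r, 'm) ring_scheme \<Rightarrow> (nat \<Rightarrow> 'r) \<Rightarrow> nat list \<Rightarrow> (nat \<Rightarrow> nat) \<Rightarrow> 'r" where
  "billey_sum n R t bs v =
     (\<Oplus>\<^bsub>R\<^esub>I\<in>{I. I \<subseteq> {..<length bs} \<and> card I = cox_length n v \<and> word_prod (nths bs I) = v}.
        foldr (\<lambda>i r. root_factor R t bs i \<otimes>\<^bsub>R\<^esub> r) (sorted_list_of_set I) \<one>\<^bsub>R\<^esub>)"

definition opposite_schubert :: "nat \<Rightarrow> (nat \<Rightarrow> nat) \<Rightarrow> complex mat set set" where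
  "opposite_schubert n v =
     flag_variety n closure_of ((\<lambda>b. left_act b (fixed_point n v)) ` opposite_Borel n)"

text \<open>\<open>S\<close> is the equivariant Schubert class of \<open>v\<close>: a class of degree \<open>2 \<ell>(v)\<close> supported on the
  closure of the opposite cell of \<open>v\<close>, which has complex codimension \<open>\<ell>(v)\<close>. These two conditions
  determine it up to a scalar, which the last one fixes.\<close>

definition schubert_class ::
    "nat \<Rightarrow> (nat \<Rightarrow> pt_class) \<Rightarrow> (nat \<Rightarrow> nat) \<Rightarrow> flag_class \<Rightarrow> bool" where
  "schubert_class n t v S \<longleftrightarrow>
     S \<in> carrier (cohomology (borel_space n (torus n) left_act (flag_variety n))) \<and>
     has_degree (2 * cox_length n v) S \<and>
     (let U = borel_space n (torus n) left_act
                (subtopology (flag_variety n)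
                  (topspace (flag_variety n) - opposite_schubert n v))
      in pullback U (borel_map (torus n) left_act (\<lambda>C. C)) S = \<zero>\<^bsub>cohomology U\<^esub>) \<and>
     (\<forall>w bs. w permutes {1..n} \<and> reduced_word n w bs \<longrightarrow>
        localize n (torus n) S w = billey_sum n (H_pt n (torus n)) t bs v)"

definition restrict_to_circle :: "nat \<Rightarrow> flag_class \<Rightarrow> flag_class" where
  "restrict_to_circle n =
     pullback (borel_space n (circle n) left_act (flag_variety n))
       (borel_map (torus n) left_act (\<lambda>C. C))"

definition restrict_to_peterson :: "nat \<Rightarrow> flag_class \<Rightarrow> flag_class" where
  "restrict_to_peterson n =
     pullback (borel_space n (circle n) left_act (peterson_variety n))
       (borel_map (circle n) left_act (\<lambda>C. C))"

definition peterson_class :: "nat \<Rightarrow> ((nat \<Rightarrow> nat) \<Rightarrow> flag_class) \<Rightarrow> (nat \<Rightarrow> nat) \<Rightarrow> flag_class" where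
  "peterson_class n \<sigma> w = restrict_to_peterson n (restrict_to_circle n (\<sigma> w))"

text \<open>The restriction \<open>p\<^sub>w(w\<^sub>A)\<close>, as an element of \<open>\<complex>[t]\<close>.\<close>

definition peterson_value ::
    "nat \<Rightarrow> (complex poly \<Rightarrow> pt_class) \<Rightarrow> ((nat \<Rightarrow> nat) \<Rightarrow> flag_class) \<Rightarrow>
     (nat \<Rightarrow> nat) \<Rightarrow> nat set \<Rightarrow> complex poly" where
  "peterson_value n \<iota> \<sigma> w A =
     the_inv_into UNIV \<iota> (localize n (circle n) (peterson_class n \<sigma> w) (w_long n A))"

end

theory Submission
  imports Defs
begin

text \<open>Restricting the group from the torus to the circle sends \<open>t\<^sub>k\<close> to \<open>(n + 1 - k) t\<close>, hence
  every factor of Billey's formula for a reduced word of \<open>w\<^sub>B\<close> to a positive multiple of \<open>t\<close>.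
  So \<open>p\<^sub>w(w\<^sub>B) = N t\<^bsup>\<ell>(w)\<^esup>\<close> where \<open>N\<close> is a natural number, nonzero exactly if \<open>w\<close> is a reduced
  subword of that word; this holds as soon as \<open>w\<close> lies in the parabolic subgroup of \<open>B\<close>, since \<open>w\<close>
  then begins a reduced word of \<open>w\<^sub>B\<close>. If \<open>p\<^sub>w(w\<^sub>A) \<noteq> 0\<close>, then \<open>w\<close> is a word in the letters of some
  \<open>B \<subseteq> A\<close>, each of which occurs. A proper subset \<open>B\<close> would give \<open>p\<^sub>w(w\<^sub>B) \<noteq> 0\<close> although \<open>w\<^sub>B\<close> is shorter
  than \<open>w\<^sub>A\<close>. Therefore \<open>B = A\<close> and \<open>\<ell>(w) \<ge> card A \<ge> \<ell>(v\<^sub>A)\<close>.\<close>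

section \<open>The cohomology ring of a space\<close>

text \<open>The value of \<open>t k\<close> on the circle is where topology enters, and the
  cohomology of the torus at a point is never computed. Only the ring of the circle is known,
  through \<open>\<iota>\<close>, with its generator pinned down by a transgression. A Chern class
  restricted to the circle is therefore \<open>\<iota> P\<close> for an unknown polynomial
  \<open>P\<close>. In degree 2 its cocycle differs from \<open>coeff P 1\<close> times the
  generating cocycle by a coboundary. Pulled back to the total space, this becomes a relation
  between two transgression cochains, and on a loop in one orbit of the circle these read off the
  winding numbers \<open>n + 1 - k\<close> and 1. The single homotopical input is that this loop
  bounds. The ring structure has to be built from singular cochains because Billey's formula is
  pushed through ring homomorphisms only. On the combinatorial side everything rests on one
  description of parabolic subgroups, by the initial segments that they preserve. It bounds the
  letters of words, detects ascents and characterizes \<open>w_long\<close> by its descents, so no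
  explicit formula for it is required.\<close>

lemma alternating_double_sum:
  fixes a :: "nat \<Rightarrow> nat \<Rightarrow> complex"
  assumes "\<And>i j. i \<le> j \<Longrightarrow> j \<le> n \<Longrightarrow> a (Suc j) i = a i j"
  shows "(\<Sum>k\<le>Suc n. \<Sum>l\<le>n. (-1) ^ (k + l) * a k l) = 0"
proof -
  let ?P = "{..Suc n} \<times> {..n}" and ?f = "\<lambda>(k, l). (-1) ^ (k + l) * a k l"
  let ?Q = "{(i, j). i \<le> j \<and> j \<le> n}"
  have 2: "{z \<in> ?P. \<not> snd z < fst z} = ?Q" by auto
  have "(\<Sum>k\<le>Suc n. \<Sum>l\<le>n. (-1) ^ (k + l) * a k l) = sum ?f ?P"
    by (simp only: sum.cartesian_product)
  also have "\<dots> = sum ?f {z \<in> ?P. snd z < fst z} + sum ?f {z \<in> ?P. \<not> snd z < fst z}"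
    by (subst sum.union_disjoint [symmetric]) (auto intro!: sum.cong)
  \<comment> \<open>A pair with \<open>l < k\<close> is matched with \<open>(l, k - 1)\<close>,
    where the exponent of the sign is one lower. The assumption is the simplicial identity.\<close>
  also have "sum ?f {z \<in> ?P. snd z < fst z} = (\<Sum>z\<in>?Q. - ?f z)"
    by (rule sum.reindex_bij_witness [of _ "\<lambda>(i, j). (Suc j, i)" "\<lambda>(k, l). (l, k - 1)"])
       (auto simp: assms add.commute power_add elim!: less_natE)
  also have "\<dots> = - sum ?f ?Q"
    by (rule sum_negf)
  finally show ?thesis unfolding 2 by simp
qed

lemma singular_face_commute:
  assumes "i \<le> j" "j \<le> Suc p"
  shows "singular_face (Suc p) i (singular_face (Suc (Suc p)) (Suc j) s) =
         singular_face (Suc p) j (singular_face (Suc (Suc p)) i s)"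
proof
  fix x
  show "singular_face (Suc p) i (singular_face (Suc (Suc p)) (Suc j) s) x =
        singular_face (Suc p) j (singular_face (Suc (Suc p)) i s) x"
  proof (cases "x \<in> standard_simplex p")
    case True
    then have "simplical_face i x \<in> standard_simplex (Suc p)"
      "simplical_face j x \<in> standard_simplex (Suc p)"
      using simplical_face_in_standard_simplex [of "Suc p" _ x] assms by auto
    moreover have "simplical_face (Suc j) (simplical_face i x) = simplical_face i (simplical_face j x)"
      using assms by (auto simp: simplical_face_def fun_eq_iff)
    ultimately show ?thesis by (simp add: singular_face_def)
  qed (simp add: singular_face_def)
qed

lemma cochainsI:
  assumes "\<And>p s. \<not> singular_simplex p X s \<Longrightarrow> f p s = 0" "\<And>p s. p \<ge> N \<Longrightarrow> f p s = 0"
  shows "f \<in> cochains X"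
  using assms unfolding cochains_def by blast

lemma cochain_not_simplex: "f \<in> cochains X \<Longrightarrow> \<not> singular_simplex p X s \<Longrightarrow> f p s = 0"
  by (auto simp: cochains_def)

lemma cochains_zero [simp]: "(\<lambda>p s. 0) \<in> cochains X"
  by (simp add: cochains_def)

lemma cochains_add [simp]:
  assumes "f \<in> cochains X" "g \<in> cochains X" shows "(\<lambda>p s. f p s + g p s) \<in> cochains X"
proof -
  obtain M N where "\<forall>p\<ge>M. \<forall>s. f p s = 0" "\<forall>p\<ge>N. \<forall>s. g p s = 0"
    using assms by (auto simp: cochains_def)
  then show ?thesis
    using assms by (intro cochainsI [where N = "max M N"]) (auto simp: cochains_def)
qed

lemma cochains_scale [simp]: "f \<in> cochains X \<Longrightarrow> (\<lambda>p s. a p * f p s) \<in> cochains X"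
  unfolding cochains_def by fastforce

lemma cochains_uminus [simp]: "f \<in> cochains X \<Longrightarrow> (\<lambda>p s. - f p s) \<in> cochains X"
  using cochains_scale [of f X "\<lambda>p. -1"] by simp

lemma cochains_diff:
  assumes "f \<in> cochains X" "g \<in> cochains X" shows "(\<lambda>p s. f p s - g p s) \<in> cochains X"
  using cochains_add [OF assms(1) cochains_uminus [OF assms(2)]] by simp

lemma cochains_const [simp]: "const_cochain X a \<in> cochains X"
  by (auto intro: cochainsI [where N = 1] simp: const_cochain_def)

lemma cochains_coboundary [simp]:
  assumes "f \<in> cochains X" shows "coboundary X f \<in> cochains X"
proof -
  obtain N where "\<forall>p\<ge>N. \<forall>s. f p s = 0"
    using assms by (auto simp: cochains_def)
  then show ?thesis
    by (intro cochainsI [where N = "Suc N"]) (auto simp: coboundary_def)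
qed

lemma cochains_cup [simp]:
  assumes "f \<in> cochains X" "g \<in> cochains X" shows "cup X f g \<in> cochains X"
proof -
  obtain M N where MN: "\<forall>p\<ge>M. \<forall>s. f p s = 0" "\<forall>p\<ge>N. \<forall>s. g p s = 0"
    using assms by (auto simp: cochains_def)
  have "f i x * g (p - i) y = 0" if "p \<ge> M + N" for p i x y
  proof (cases "i \<ge> M")
    case False
    then have "p - i \<ge> N" using that by simp
    then show ?thesis using MN by simp
  qed (use MN in simp)
  then show ?thesis
    by (intro cochainsI [where N = "M + N"]) (auto simp: cup_def intro!: sum.neutral)
qed

lemma coboundary_add:
  "coboundary X (\<lambda>p s. f p s + g p s) = (\<lambda>p s. coboundary X f p s + coboundary X g p s)"
  by (auto simp: coboundary_def fun_eq_iff sum.distrib algebra_simps)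

text \<open>The factor may depend on the degree, which covers negation, the sign
  \<open>(-1) ^ p\<close> of the Leibniz rule and the projection to one degree. At
  \<open>p = 0\<close> the truncated \<open>p - 1\<close> is harmless, since every coboundary
  vanishes there.\<close>

lemma coboundary_scale: "coboundary X (\<lambda>p s. a p * f p s) = (\<lambda>p s. a (p - 1) * coboundary X f p s)"
  by (auto simp: coboundary_def fun_eq_iff sum_distrib_left algebra_simps)

lemma coboundary_diff:
  "coboundary X (\<lambda>p s. f p s - g p s) = (\<lambda>p s. coboundary X f p s - coboundary X g p s)"
  by (auto simp: coboundary_def fun_eq_iff sum_subtractf algebra_simps)

lemma coboundary_0: "coboundary X f 0 s = 0"
  by (simp add: coboundary_def)

lemma coboundary_zero [simp]: "coboundary X (\<lambda>p s. 0) = (\<lambda>p s. 0)"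
  by (auto simp: coboundary_def fun_eq_iff)

lemma coboundary_coboundary: "coboundary X (coboundary X f) = (\<lambda>p s. 0)"
proof (intro ext)
  fix p s
  show "coboundary X (coboundary X f) p s = 0"
  proof (cases "\<exists>n. p = Suc (Suc n) \<and> singular_simplex p X s")
    case True
    then obtain n where p: "p = Suc (Suc n)" and s: "singular_simplex p X s" by blast
    have face: "singular_simplex (Suc n) X (singular_face p k s)" if "k \<le> p" for k
      using singular_simplex_singular_face [OF s] that p by simp
    have "coboundary X (coboundary X f) p s =
        (\<Sum>k\<le>Suc (Suc n). \<Sum>l\<le>Suc n. (-1) ^ (k + l) * f n (singular_face (Suc n) l (singular_face p k s)))"
      using s face unfolding coboundary_def
      by (simp add: p sum_distrib_left power_add mult.assoc del: sum.atMost_Suc)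
    also have "\<dots> = 0"
      unfolding p by (rule alternating_double_sum) (simp add: singular_face_commute)
    finally show ?thesis .
  next
    case False
    then consider "p = 0" | "p = 1" | "\<not> singular_simplex p X s"
      by (metis One_nat_def not0_implies_Suc)
    then show ?thesis by cases (auto simp: coboundary_def)
  qed
qed

lemma coboundary_const [simp]: "coboundary X (const_cochain X a) = (\<lambda>p s. 0)"
proof (intro ext)
  fix p s
  have "singular_simplex 0 X (singular_face (Suc 0) k s)"
    if "singular_simplex (Suc 0) X s" "k \<le> 1" for k
    using singular_simplex_singular_face [OF that(1)] that(2) by simp
  then show "coboundary X (const_cochain X a) p s = 0"
    by (cases "p = 1") (auto simp: coboundary_def const_cochain_def)
qed

subsection \<open>Cup products\<close>

text \<open>The inclusion of the face spanned by the vertices \<open>i, ..., i + j\<close>, isolated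
  from \<open>back_face\<close> so that a back face becomes a composition.\<close>

definition simplex_shift :: "nat \<Rightarrow> (nat \<Rightarrow> real) \<Rightarrow> nat \<Rightarrow> real" where
  "simplex_shift i x = (\<lambda>k. if k < i then 0 else x (k - i))"

lemma simplex_shift_in:
  assumes "x \<in> standard_simplex j" shows "simplex_shift i x \<in> standard_simplex (i + j)"
proof -
  have "(\<Sum>k\<le>i + j. simplex_shift i x k) = (\<Sum>k\<in>{i..i + j}. simplex_shift i x k)"
    by (rule sum.mono_neutral_right)
       (auto simp: simplex_shift_def)
  also have "\<dots> = (\<Sum>k\<le>j. x k)"
    by (rule sum.reindex_bij_witness [of _ "\<lambda>k. i + k" "\<lambda>k. k - i"]) (auto simp: simplex_shift_def)
  finally show ?thesis
    using assms by (auto simp: standard_simplex_def simplex_shift_def)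
qed

lemma back_face_alt: "back_face i j s = restrict (s \<circ> simplex_shift i) (standard_simplex j)"
  by (simp add: back_face_def simplex_shift_def o_def)

lemma continuous_map_simplex_shift:
  "continuous_map (subtopology (powertop_real UNIV) (standard_simplex j))
     (subtopology (powertop_real UNIV) (standard_simplex (i + j))) (simplex_shift i)"
proof -
  have "continuous_map (powertop_real UNIV) euclideanreal (\<lambda>x. simplex_shift i x k)" for k
    by (cases "k < i") (auto simp: simplex_shift_def intro: continuous_map_product_projection)
  then show ?thesis
    by (auto simp: continuous_map_in_subtopology continuous_map_componentwise simplex_shift_in
             intro: continuous_map_from_subtopology)
qed

lemma singular_simplex_front_face:
  assumes "singular_simplex p X s" "i \<le> p"
  shows "singular_simplex i X (front_face i s)"
proof -
  have "continuous_map (subtopology (powertop_real UNIV) (standard_simplex i)) X s"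
    using assms standard_simplex_mono [OF assms(2)] unfolding singular_simplex_def
    by (metis continuous_map_from_subtopology_mono)
  then show ?thesis
    by (auto simp: singular_simplex_def front_face_def intro: continuous_map_eq)
qed

lemma singular_simplex_back_face:
  assumes "singular_simplex (i + j) X s"
  shows "singular_simplex j X (back_face i j s)"
proof -
  have "continuous_map (subtopology (powertop_real UNIV) (standard_simplex j)) X (s \<circ> simplex_shift i)"
    using assms continuous_map_simplex_shift unfolding singular_simplex_def
    by (metis continuous_map_compose)
  then show ?thesis
    by (auto simp: singular_simplex_def back_face_alt intro: continuous_map_eq)
qed

lemma singular_simplex_back_face_diff:
  "singular_simplex p X s \<Longrightarrow> i \<le> p \<Longrightarrow> singular_simplex (p - i) X (back_face i (p - i) s)"
  using singular_simplex_back_face [of i "p - i"] by simp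

text \<open>In this and the next three lemmas a simplex is cut at a vertex and another vertex
  \<open>k\<close> is deleted, which changes only the half containing \<open>k\<close>. The cases
  overlap at the cut (\<open>k = Suc i\<close> for the front half, \<open>k = i\<close> for the back
  half), and this overlap yields the cancelling terms of the Leibniz rule.\<close>

lemma front_face_face_high:
  assumes "i < k" "k \<le> Suc p" "i \<le> p"
  shows "front_face i (singular_face (Suc p) k s) = front_face i s"
proof
  fix x
  show "front_face i (singular_face (Suc p) k s) x = front_face i s x"
  proof (cases "x \<in> standard_simplex i")
    case True
    then have "simplical_face k x = x" "x \<in> standard_simplex p"
      using assms standard_simplex_mono [of i p] by (auto simp: standard_simplex_def simplical_face_def fun_eq_iff)
    then show ?thesis using True by (simp add: front_face_def singular_face_def)
  qed (simp add: front_face_def)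
qed

lemma front_face_face_low:
  assumes "k \<le> Suc i" "i \<le> p"
  shows "front_face i (singular_face (Suc p) k s) = singular_face (Suc i) k (front_face (Suc i) s)"
proof
  fix x
  show "front_face i (singular_face (Suc p) k s) x = singular_face (Suc i) k (front_face (Suc i) s) x"
  proof (cases "x \<in> standard_simplex i")
    case True
    moreover have "x \<in> standard_simplex p" "simplical_face k x \<in> standard_simplex (Suc i)"
      using True assms standard_simplex_mono [of i p] simplical_face_in_standard_simplex [of "Suc i" k x] by auto
    ultimately show ?thesis by (simp add: front_face_def singular_face_def)
  qed (simp add: front_face_def singular_face_def)
qed

lemma back_face_face_low:
  assumes "k \<le> i" "i + j = p"
  shows "back_face i j (singular_face (Suc p) k s) = back_face (Suc i) j s"
proof
  fix x
  show "back_face i j (singular_face (Suc p) k s) x = back_face (Suc i) j s x"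
  proof (cases "x \<in> standard_simplex j")
    case True
    moreover have "simplical_face k (simplex_shift i x) = simplex_shift (Suc i) x"
      using assms by (auto simp: simplical_face_def simplex_shift_def fun_eq_iff)
    ultimately show ?thesis
      using simplex_shift_in [OF True] assms by (auto simp: back_face_alt singular_face_def)
  qed (simp add: back_face_def)
qed

lemma back_face_face_high:
  assumes "l \<le> Suc j" "i + j = p"
  shows "back_face i j (singular_face (Suc p) (i + l) s) = singular_face (Suc j) l (back_face i (Suc j) s)"
proof
  fix x
  show "back_face i j (singular_face (Suc p) (i + l) s) x = singular_face (Suc j) l (back_face i (Suc j) s) x"
  proof (cases "x \<in> standard_simplex j")
    case True
    moreover have "simplical_face (i + l) (simplex_shift i x) = simplex_shift i (simplical_face l x)"
      using assms by (auto simp: simplical_face_def simplex_shift_def fun_eq_iff diff_right_commute)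
    ultimately show ?thesis
      using simplex_shift_in [OF True] assms simplical_face_in_standard_simplex [of "Suc j" l x]
      by (auto simp: back_face_alt singular_face_def)
  qed (simp add: back_face_def singular_face_def)
qed

text \<open>For each cut \<open>i\<close>, faces up to \<open>i\<close> act on the front half and
  later ones on the back half. The front half then lacks its last face and the back half its face 0.
  Both missing terms are \<open>?B i\<close> up to sign, with opposite signs, so they may be added
  at no cost.\<close>

lemma coboundary_cup:
  "coboundary X (cup X f g) = (\<lambda>p s. cup X (coboundary X f) g p s +
     cup X (\<lambda>p s. (-1) ^ p * f p s) (coboundary X g) p s)"
proof (intro ext)
  fix m s
  show "coboundary X (cup X f g) m s = cup X (coboundary X f) g m s +
     cup X (\<lambda>p s. (-1) ^ p * f p s) (coboundary X g) m s"
  proof (cases "singular_simplex m X s \<and> m > 0")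
    case True
    then obtain p where m: "m = Suc p" and s: "singular_simplex (Suc p) X s"
      by (cases m) auto
    note face = singular_simplex_singular_face [OF s, simplified]
    note front = singular_simplex_front_face [OF s]
    note backf = singular_simplex_back_face_diff [OF s]
    define F where "F i = front_face i s" for i
    define G where "G i = back_face i (Suc p - i) s" for i
    let ?F = "\<lambda>i k. f i (singular_face (Suc i) k (F (Suc i)))"
    let ?G = "\<lambda>i l. g (p - i) (singular_face (Suc (p - i)) l (G i))"
    let ?B = "\<lambda>i. (-1) ^ i * f i (F i) * g (p - i) (G (Suc i))"
    have tm: "(\<Sum>k\<le>Suc p. (-1) ^ k * (f i (front_face i (singular_face (Suc p) k s)) *
          g (p - i) (back_face i (p - i) (singular_face (Suc p) k s)))) =
        ((\<Sum>k\<le>Suc i. (-1) ^ k * ?F i k) * g (p - i) (G (Suc i)) + ?B i) +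
        ((-1) ^ i * f i (F i) * (\<Sum>l\<le>Suc (p - i). (-1) ^ l * ?G i l) - ?B i)"
      (is "?lhs = ?R1 + ?R2") if i: "i \<le> p" for i
    proof -
      let ?t = "\<lambda>k. (-1) ^ k * (f i (front_face i (singular_face (Suc p) k s)) *
          g (p - i) (back_face i (p - i) (singular_face (Suc p) k s)))"
      have "(\<lambda>l. i + l) ` {1..Suc (p - i)} = {Suc i..Suc p}"
        using i by simp
      then have split: "{..Suc p} = {..i} \<union> (\<lambda>l. i + l) ` {1..Suc (p - i)}"
        using i by auto
      have "?lhs = sum ?t {..i} + sum ?t ((\<lambda>l. i + l) ` {1..Suc (p - i)})"
        unfolding split by (rule sum.union_disjoint) auto
      also have "sum ?t {..i} = (\<Sum>k\<le>i. (-1) ^ k * ?F i k) * g (p - i) (G (Suc i))"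
        unfolding sum_distrib_right F_def G_def using i
        by (intro sum.cong) (auto simp: front_face_face_low back_face_face_low)
      also have "\<dots> = ?R1"
        using i front_face_face_high [of i "Suc i" p s] front_face_face_low [of "Suc i" i p s]
        by (simp add: F_def algebra_simps)
      also have "sum ?t ((\<lambda>l. i + l) ` {1..Suc (p - i)}) = (\<Sum>l\<in>{1..Suc (p - i)}. ?t (i + l))"
        by (subst sum.reindex) (auto simp: inj_on_def)
      also have "\<dots> = (-1) ^ i * f i (F i) * (\<Sum>l\<in>{1..Suc (p - i)}. (-1) ^ l * ?G i l)"
        unfolding sum_distrib_left F_def G_def using i
        by (intro sum.cong)
           (auto simp: front_face_face_high back_face_face_high power_add Suc_diff_le)
      also have "(\<Sum>l\<in>{1..Suc (p - i)}. (-1) ^ l * ?G i l) =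
          (\<Sum>l\<le>Suc (p - i). (-1) ^ l * ?G i l) - ?G i 0"
        by (simp add: atMost_atLeast0 sum.atLeast_Suc_atMost)
      also have "?G i 0 = g (p - i) (G (Suc i))"
        using i back_face_face_high [of 0 "p - i" i p s] back_face_face_low [of i i "p - i" p s]
        by (simp add: G_def Suc_diff_le)
      finally show ?thesis by (simp add: algebra_simps)
    qed
    have "coboundary X (cup X f g) m s = (\<Sum>k\<le>Suc p. \<Sum>i\<le>p. (-1) ^ k *
        (f i (front_face i (singular_face (Suc p) k s)) *
          g (p - i) (back_face i (p - i) (singular_face (Suc p) k s))))"
      using s face by (simp add: m coboundary_def cup_def sum_distrib_left del: sum.atMost_Suc)
    also have "\<dots> = (\<Sum>i\<le>p. (\<Sum>k\<le>Suc i. (-1) ^ k * ?F i k) * g (p - i) (G (Suc i)) +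
        (-1) ^ i * f i (F i) * (\<Sum>l\<le>Suc (p - i). (-1) ^ l * ?G i l))"
      by (subst sum.swap) (intro sum.cong refl, simp add: tm del: sum.atMost_Suc)
    also have "\<dots> = (\<Sum>i\<le>p. coboundary X f (Suc i) (F (Suc i)) * g (p - i) (G (Suc i))) +
        (\<Sum>i\<le>p. (-1) ^ i * f i (F i) * coboundary X g (Suc (p - i)) (G i))"
    proof -
      have "coboundary X f (Suc i) (F (Suc i)) = (\<Sum>k\<le>Suc i. (-1) ^ k * ?F i k)" if "i \<le> p" for i
        using front that by (simp add: coboundary_def F_def del: sum.atMost_Suc)
      moreover have "coboundary X g (Suc (p - i)) (G i) = (\<Sum>l\<le>Suc (p - i). (-1) ^ l * ?G i l)" if "i \<le> p" for i
        using backf [of i] that by (simp add: coboundary_def G_def Suc_diff_le del: sum.atMost_Suc)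
      ultimately show ?thesis by (simp add: sum.distrib del: sum.atMost_Suc)
    qed
    \<comment> \<open>The cup product has one more cut, whose term contains a coboundary in degree 0
      and so vanishes. The same happens at the other end for the second sum.\<close>
    also have "(\<Sum>i\<le>p. coboundary X f (Suc i) (F (Suc i)) * g (p - i) (G (Suc i))) =
        cup X (coboundary X f) g m s"
      using s by (simp add: m cup_def F_def G_def sum.atMost_Suc_shift coboundary_0 del: sum.atMost_Suc)
    also have "(\<Sum>i\<le>p. (-1) ^ i * f i (F i) * coboundary X g (Suc (p - i)) (G i)) =
        cup X (\<lambda>p s. (-1) ^ p * f p s) (coboundary X g) m s"
      using s by (simp add: m cup_def F_def G_def coboundary_0 Suc_diff_le)
    finally show ?thesis .
  qed (auto simp: coboundary_def cup_def)
qed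

lemma front_front: "i \<le> j \<Longrightarrow> front_face i (front_face j s) = front_face i s"
  using standard_simplex_mono [of i j] by (auto simp: front_face_def fun_eq_iff restrict_def)

lemma back_back:
  "back_face j k (back_face i (j + k) s) = back_face (i + j) k s"
proof
  fix x
  have "simplex_shift i (simplex_shift j x) = simplex_shift (i + j) x"
    by (auto simp: simplex_shift_def fun_eq_iff)
  then show "back_face j k (back_face i (j + k) s) x = back_face (i + j) k s x"
    using simplex_shift_in [of x k j] by (simp add: back_face_alt restrict_def)
qed

lemma front_back: "front_face j (back_face i (j + k) s) = back_face i j (front_face (i + j) s)"
proof
  fix x
  show "front_face j (back_face i (j + k) s) x = back_face i j (front_face (i + j) s) x"
    using simplex_shift_in [of x j i] standard_simplex_mono [of j "j + k"]
    by (auto simp: back_face_alt front_face_def restrict_def)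
qed

text \<open>Both sides run over all cuts of a simplex into a front, a middle and a back piece; only
  the order of summation differs.\<close>

lemma cup_assoc: "cup X (cup X f g) h = cup X f (cup X g h)"
proof (intro ext)
  fix p s
  show "cup X (cup X f g) h p s = cup X f (cup X g h) p s"
  proof (cases "singular_simplex p X s")
    case True
    let ?t = "\<lambda>i j. f i (front_face i s) * g j (front_face j (back_face i (p - i) s)) *
        h (p - i - j) (back_face (i + j) (p - i - j) s)"
    have "cup X (cup X f g) h p s = (\<Sum>m\<le>p. \<Sum>i\<le>m. ?t i (m - i))"
    proof -
      have "front_face (m - i) (back_face i (p - i) s) = back_face i (m - i) (front_face m s)"
        if "i \<le> m" "m \<le> p" for i m
        using front_back [of "m - i" i "p - m" s] that by simp
      then show ?thesis
        using True by (auto simp: cup_def singular_simplex_front_face sum_distrib_right front_front intro!: sum.cong)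
    qed
    also have "\<dots> = (\<Sum>i\<le>p. \<Sum>j\<le>p - i. ?t i j)"
      unfolding sum.triangle_reindex_eq [of ?t p, symmetric]
      by (subst sum.Sigma) (auto intro!: sum.cong)
    also have "\<dots> = cup X f (cup X g h) p s"
    proof -
      have "back_face j (p - i - j) (back_face i (p - i) s) = back_face (i + j) (p - i - j) s"
        if "i \<le> p" "j \<le> p - i" for i j
        using back_back [of j "p - i - j" i s] that by simp
      then show ?thesis
        using True singular_simplex_back_face_diff [OF True]
        by (auto simp: cup_def sum_distrib_left mult.assoc intro!: sum.cong)
    qed
    finally show ?thesis .
  qed (simp add: cup_def)
qed

lemma cup_const_left:
  assumes "f \<in> cochains X" shows "cup X (const_cochain X a) f = (\<lambda>p s. a * f p s)"
proof (intro ext)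
  fix p s
  show "cup X (const_cochain X a) f p s = a * f p s"
  proof (cases "singular_simplex p X s")
    case True
    have b0: "back_face 0 p s = s"
      using True by (auto simp: back_face_def singular_simplex_def fun_eq_iff restrict_def extensional_def)
    have "const_cochain X a i (front_face i s) * f (p - i) (back_face i (p - i) s) =
        (if i = 0 then a * f p s else 0)" for i
      using singular_simplex_front_face [OF True, of 0] b0 by (simp add: const_cochain_def)
    then show ?thesis using True by (simp add: cup_def)
  qed (use assms in \<open>simp add: cup_def cochain_not_simplex\<close>)
qed

lemma cup_const_right:
  assumes "f \<in> cochains X" shows "cup X f (const_cochain X a) = (\<lambda>p s. a * f p s)"
proof (intro ext)
  fix p s
  show "cup X f (const_cochain X a) p s = a * f p s"
  proof (cases "singular_simplex p X s")
    case True
    have b0: "front_face p s = s"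
      using True by (auto simp: front_face_def singular_simplex_def fun_eq_iff restrict_def extensional_def)
    have "f i (front_face i s) * const_cochain X a (p - i) (back_face i (p - i) s) =
        (if i = p then a * f p s else 0)" if "i \<le> p" for i
      using singular_simplex_back_face_diff [OF True, of p] b0 that by (simp add: const_cochain_def)
    then have "cup X f (const_cochain X a) p s = (\<Sum>i\<le>p. if i = p then a * f p s else 0)"
      unfolding cup_def by (simp only: True if_True, intro sum.cong) auto
    then show ?thesis by simp
  qed (use assms in \<open>simp add: cup_def cochain_not_simplex\<close>)
qed

lemma cup_add_left: "cup X (\<lambda>p s. f p s + g p s) h = (\<lambda>p s. cup X f h p s + cup X g h p s)"
  by (auto simp: cup_def fun_eq_iff sum.distrib algebra_simps)

lemma cup_add_right: "cup X h (\<lambda>p s. f p s + g p s) = (\<lambda>p s. cup X h f p s + cup X h g p s)"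
  by (auto simp: cup_def fun_eq_iff sum.distrib algebra_simps)

lemma cocycle_ring_simps [simp]:
  "monoid.mult (cocycle_ring X) = cup X"
  "one (cocycle_ring X) = const_cochain X 1"
  "zero (cocycle_ring X) = (\<lambda>p s. 0)"
  "add (cocycle_ring X) = (\<lambda>f g p s. f p s + g p s)"
  by (simp_all add: cocycle_ring_def)

lemma cocycle_iff:
  "f \<in> carrier (cocycle_ring X) \<longleftrightarrow> f \<in> cochains X \<and> coboundary X f = (\<lambda>p s. 0)"
  by (simp add: cocycle_ring_def)

lemma cup_zero_left [simp]: "cup X (\<lambda>p s. 0) g = (\<lambda>p s. 0)"
  and cup_zero_right [simp]: "cup X f (\<lambda>p s. 0) = (\<lambda>p s. 0)"
  by (simp_all add: cup_def fun_eq_iff)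

lemma cocycle_cup:
  "f \<in> carrier (cocycle_ring X) \<Longrightarrow> g \<in> carrier (cocycle_ring X) \<Longrightarrow> cup X f g \<in> carrier (cocycle_ring X)"
  by (simp add: cocycle_iff coboundary_cup)

lemma cocycle_scale:
  "f \<in> carrier (cocycle_ring X) \<Longrightarrow> (\<lambda>p s. a p * f p s) \<in> carrier (cocycle_ring X)"
  by (simp add: cocycle_iff coboundary_scale)

lemma cocycle_const: "const_cochain X a \<in> carrier (cocycle_ring X)"
  by (simp add: cocycle_iff)

lemma ring_cocycle_ring: "ring (cocycle_ring X)"
proof (rule ringI)
  show "abelian_group (cocycle_ring X)"
  proof (rule abelian_groupI)
    fix f assume f: "f \<in> carrier (cocycle_ring X)"
    show "\<exists>g\<in>carrier (cocycle_ring X). g \<oplus>\<^bsub>cocycle_ring X\<^esub> f = \<zero>\<^bsub>cocycle_ring X\<^esub>"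
      using cocycle_scale [OF f, of "\<lambda>p. -1"] by (intro bexI [of _ "\<lambda>p s. - f p s"]) simp_all
  qed (auto simp: cocycle_iff coboundary_add add_ac)
  show "monoid (cocycle_ring X)"
    using cup_const_left [of _ X 1] cup_const_right [of _ X 1]
    by (intro monoidI) (simp_all add: cocycle_cup cocycle_const cup_assoc, simp_all add: cocycle_iff)
qed (simp_all add: cup_add_left cup_add_right)

section \<open>The ideal of coboundaries and its cosets\<close>

lemma coboundaries_subset: "coboundaries X \<subseteq> carrier (cocycle_ring X)"
  by (auto simp: coboundaries_def cocycle_iff coboundary_coboundary)

lemma coboundariesE:
  assumes "f \<in> coboundaries X" obtains h where "h \<in> cochains X" "f = coboundary X h"
  using assms by (auto simp: coboundaries_def)

lemma coboundaries_scale: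
  assumes "f \<in> coboundaries X" shows "(\<lambda>p s. a p * f p s) \<in> coboundaries X"
proof -
  obtain h where "h \<in> cochains X" "f = coboundary X h" using assms by (rule coboundariesE)
  \<comment> \<open>The primitive lives one degree lower, hence \<open>a (Suc p)\<close>. In degree
    0 both sides are 0.\<close>
  then have "(\<lambda>p s. a p * f p s) = coboundary X (\<lambda>p s. a (Suc p) * h p s)"
    by (auto simp: coboundary_scale fun_eq_iff coboundary_def)
  then show ?thesis using \<open>h \<in> cochains X\<close> by (simp add: coboundaries_def)
qed

lemma cocycle_ring_uminus:
  assumes "f \<in> carrier (cocycle_ring X)" shows "\<ominus>\<^bsub>cocycle_ring X\<^esub> f = (\<lambda>p s. - f p s)"
proof -
  interpret ring "cocycle_ring X" by (rule ring_cocycle_ring)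
  show ?thesis
    using cocycle_scale [OF assms, of "\<lambda>p. -1"] assms by (intro minus_equality) simp_all
qed

lemma ideal_coboundaries: "ideal (coboundaries X) (cocycle_ring X)"
proof -
  interpret ring "cocycle_ring X" by (rule ring_cocycle_ring)
  show ?thesis
  proof (rule idealI [OF ring_cocycle_ring])
    show "subgroup (coboundaries X) (add_monoid (cocycle_ring X))"
    proof (rule add.subgroupI)
      show "coboundaries X \<subseteq> carrier (cocycle_ring X)"
        by (rule coboundaries_subset)
      show "coboundaries X \<noteq> {}"
        by (metis cochains_zero empty_iff image_is_empty coboundaries_def)
    next
      fix f assume f: "f \<in> coboundaries X"
      then show "\<ominus>\<^bsub>cocycle_ring X\<^esub> f \<in> coboundaries X"
        using coboundaries_scale [OF f, of "\<lambda>p. -1"]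
        by (simp add: cocycle_ring_uminus [OF subsetD [OF coboundaries_subset f]])
      fix g assume g: "g \<in> coboundaries X"
      obtain h k where "h \<in> cochains X" "f = coboundary X h" "k \<in> cochains X" "g = coboundary X k"
        using f g by (metis coboundariesE)
      then show "f \<oplus>\<^bsub>cocycle_ring X\<^esub> g \<in> coboundaries X"
        by (simp add: coboundaries_def coboundary_add [symmetric])
    qed
  next
    fix f g assume f: "f \<in> coboundaries X" and g: "g \<in> carrier (cocycle_ring X)"
    obtain h where h: "h \<in> cochains X" "f = coboundary X h" using f by (rule coboundariesE)
    have "cup X f g = coboundary X (cup X h g)"
      using g h by (simp add: coboundary_cup cocycle_iff)
    then show "f \<otimes>\<^bsub>cocycle_ring X\<^esub> g \<in> coboundaries X"
      using g h by (simp add: coboundaries_def cocycle_iff)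
    \<comment> \<open>The twist absorbs the Leibniz sign: the coboundary of
      \<open>cup X g' h\<close> is exactly \<open>cup X g f\<close>, because applying the sign twice
      restores \<open>g\<close>.\<close>
    define g' where "g' = (\<lambda>p s. (-1) ^ p * g p s)"
    have g': "g' \<in> carrier (cocycle_ring X)"
      unfolding g'_def by (rule cocycle_scale [OF g])
    moreover have "(\<lambda>p s. (-1) ^ p * g' p s) = g"
      by (simp add: g'_def fun_eq_iff mult.assoc [symmetric] power_mult_distrib [symmetric])
    ultimately have "cup X g f = coboundary X (cup X g' h)"
      using h by (simp add: coboundary_cup cocycle_iff)
    then show "g \<otimes>\<^bsub>cocycle_ring X\<^esub> f \<in> coboundaries X"
      using g' h by (simp add: coboundaries_def cocycle_iff)
  qed
qed

lemma ring_cohomology: "ring (cohomology X)"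
  unfolding cohomology_def by (rule ideal.quotient_is_ring [OF ideal_coboundaries])

definition coho_class :: "'a topology \<Rightarrow> 'a cochain \<Rightarrow> 'a cochain set" where
  "coho_class X f = coboundaries X +>\<^bsub>cocycle_ring X\<^esub> f"

lemma const_class_eq: "const_class X a = coho_class X (const_cochain X a)"
  by (simp add: const_class_def coho_class_def)

lemma coho_class_hom: "coho_class X \<in> Ring.ring_hom (cocycle_ring X) (cohomology X)"
  using ideal.rcos_ring_hom [OF ideal_coboundaries, of X]
  by (simp add: coho_class_def [abs_def] cohomology_def)

lemma carrier_cohomology: "carrier (cohomology X) = coho_class X ` carrier (cocycle_ring X)"
  unfolding cohomology_def FactRing_simps coho_class_def by auto

lemma coho_class_mult:
  "f \<in> carrier (cocycle_ring X) \<Longrightarrow> g \<in> carrier (cocycle_ring X) \<Longrightarrow>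
     coho_class X f \<otimes>\<^bsub>cohomology X\<^esub> coho_class X g = coho_class X (cup X f g)"
  using ring_hom_mult [OF coho_class_hom, of f X g] by simp

lemma coho_class_add:
  "f \<in> carrier (cocycle_ring X) \<Longrightarrow> g \<in> carrier (cocycle_ring X) \<Longrightarrow>
     coho_class X f \<oplus>\<^bsub>cohomology X\<^esub> coho_class X g = coho_class X (\<lambda>p s. f p s + g p s)"
  using ring_hom_add [OF coho_class_hom, of f X g] by simp

lemma coho_class_one: "\<one>\<^bsub>cohomology X\<^esub> = coho_class X (const_cochain X 1)"
  using ring_hom_one [OF coho_class_hom, of X] by simp

lemma in_coho_class_iff:
  "g \<in> coho_class X f \<longleftrightarrow> (\<exists>h\<in>cochains X. g = (\<lambda>p s. coboundary X h p s + f p s))"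
  by (auto simp: coho_class_def a_r_coset_def r_coset_def coboundaries_def)

lemma coho_class_self: "f \<in> coho_class X f"
  unfolding in_coho_class_iff by (rule bexI [of _ "\<lambda>p s. 0"]) simp_all

lemma coho_class_cocycle:
  "f \<in> carrier (cocycle_ring X) \<Longrightarrow> g \<in> coho_class X f \<Longrightarrow> g \<in> carrier (cocycle_ring X)"
  by (auto simp: in_coho_class_iff cocycle_iff coboundary_add coboundary_coboundary)

lemma coho_class_eqI:
  assumes "g \<in> coho_class X f" shows "coho_class X g = coho_class X f"
proof -
  obtain h where h: "h \<in> cochains X" "g = (\<lambda>p s. coboundary X h p s + f p s)"
    using assms by (auto simp: in_coho_class_iff)
  show ?thesis
  proof (intro equalityI subsetI)
    fix k assume "k \<in> coho_class X g"
    then obtain l where "l \<in> cochains X" "k = (\<lambda>p s. coboundary X l p s + g p s)"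
      by (auto simp: in_coho_class_iff)
    then show "k \<in> coho_class X f"
      unfolding in_coho_class_iff using h
      by (intro bexI [of _ "\<lambda>p s. l p s + h p s"]) (simp_all add: coboundary_add add.assoc)
  next
    fix k assume "k \<in> coho_class X f"
    then obtain l where "l \<in> cochains X" "k = (\<lambda>p s. coboundary X l p s + f p s)"
      by (auto simp: in_coho_class_iff)
    then show "k \<in> coho_class X g"
      unfolding in_coho_class_iff using h
      by (intro bexI [of _ "\<lambda>p s. l p s - h p s"]) (simp_all add: coboundary_diff cochains_diff)
  qed
qed

text \<open>Any member of a class may represent it. This matters because \<open>chern_class\<close>
  hands over one particular member, chosen for being concentrated in degree 2.\<close>

lemma carrier_cohomology_coset:
  assumes "C \<in> carrier (cohomology X)" "c \<in> C"
  shows "c \<in> carrier (cocycle_ring X)" "C = coho_class X c"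
  using assms coho_class_cocycle coho_class_eqI by (fastforce simp: carrier_cohomology)+

subsection \<open>Functoriality\<close>

lemma pullback_cochain_in:
  assumes "f \<in> cochains Y" shows "pullback_cochain X F f \<in> cochains X"
  using assms unfolding cochains_def pullback_cochain_def by fastforce

lemma coboundary_pullback:
  assumes "continuous_map X Y F"
  shows "coboundary X (pullback_cochain X F f) = pullback_cochain X F (coboundary Y f)"
proof (intro ext)
  fix p s
  show "coboundary X (pullback_cochain X F f) p s = pullback_cochain X F (coboundary Y f) p s"
  proof (cases "singular_simplex p X s \<and> p > 0")
    case True
    then have "singular_simplex (p - 1) X (singular_face p k s)" if "k \<le> p" for k
      using singular_simplex_singular_face that by fastforce
    moreover have "simplex_map (p - 1) F (singular_face p k s) = singular_face p k (simplex_map p F s)"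
      if "k \<le> p" for k
      using singular_face_simplex_map [of p k F s] True that
      by (auto simp: simplex_map_def singular_face_def restrict_def)
    ultimately show ?thesis
      using True singular_simplex_simplex_map [OF _ assms] by (simp add: coboundary_def pullback_cochain_def)
  qed (auto simp: coboundary_def pullback_cochain_def)
qed

lemma pullback_cup:
  assumes "continuous_map X Y F"
  shows "pullback_cochain X F (cup Y f g) = cup X (pullback_cochain X F f) (pullback_cochain X F g)"
proof (intro ext)
  fix p s
  show "pullback_cochain X F (cup Y f g) p s = cup X (pullback_cochain X F f) (pullback_cochain X F g) p s"
  proof (cases "singular_simplex p X s")
    case True
    have "front_face i (simplex_map p F s) = simplex_map i F (front_face i s)" if "i \<le> p" for i
      using standard_simplex_mono [OF that]
      by (auto simp: front_face_def simplex_map_def fun_eq_iff restrict_def)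
    moreover have "back_face i (p - i) (simplex_map p F s) = simplex_map (p - i) F (back_face i (p - i) s)"
      if "i \<le> p" for i
      using simplex_shift_in [of _ "p - i" i] that
      by (auto simp: back_face_alt simplex_map_def fun_eq_iff restrict_def)
    ultimately show ?thesis
      using True singular_simplex_simplex_map [OF True assms] singular_simplex_front_face [OF True]
        singular_simplex_back_face_diff [OF True]
      by (simp add: cup_def pullback_cochain_def)
  qed (auto simp: cup_def pullback_cochain_def)
qed

lemma pullback_const_cochain:
  assumes "continuous_map X Y F"
  shows "pullback_cochain X F (const_cochain Y a) = const_cochain X a"
  using singular_simplex_simplex_map [OF _ assms, of 0]
  by (auto simp: pullback_cochain_def const_cochain_def fun_eq_iff)

lemma pullback_cochain_add:
  "pullback_cochain X F (\<lambda>p s. f p s + g p s) = (\<lambda>p s. pullback_cochain X F f p s + pullback_cochain X F g p s)"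
  by (simp add: pullback_cochain_def fun_eq_iff)

lemma pullback_cochain_zero: "pullback_cochain X F (\<lambda>p s. 0) = (\<lambda>p s. 0)"
  by (simp add: pullback_cochain_def fun_eq_iff)

lemma pullback_cocycle:
  assumes "continuous_map X Y F" "f \<in> carrier (cocycle_ring Y)"
  shows "pullback_cochain X F f \<in> carrier (cocycle_ring X)"
  using assms pullback_cochain_in [of f Y X F]
  by (simp add: cocycle_iff coboundary_pullback pullback_cochain_zero)

text \<open>\<open>pullback\<close> is a union over all representatives. Pulling back commutes with
  the coboundary, so all the cosets in that union coincide.\<close>

lemma pullback_coho_class:
  assumes "continuous_map X Y F" "f \<in> carrier (cocycle_ring Y)"
  shows "pullback X F (coho_class Y f) = coho_class X (pullback_cochain X F f)"
proof -
  have "coho_class X (pullback_cochain X F g) = coho_class X (pullback_cochain X F f)"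
    if g: "g \<in> coho_class Y f" for g
  proof -
    obtain h where h: "h \<in> cochains Y" "g = (\<lambda>p s. coboundary Y h p s + f p s)"
      using g by (auto simp: in_coho_class_iff)
    have "pullback_cochain X F g \<in> coho_class X (pullback_cochain X F f)"
      unfolding in_coho_class_iff using h pullback_cochain_in [OF h(1)]
      by (intro bexI [of _ "pullback_cochain X F h"])
         (simp_all add: pullback_cochain_add coboundary_pullback [OF assms(1)])
    then show ?thesis by (rule coho_class_eqI)
  qed
  then show ?thesis
    unfolding pullback_def coho_class_def [symmetric] using coho_class_self by blast
qed

lemma pullback_ring_hom:
  assumes "continuous_map X Y F"
  shows "pullback X F \<in> Ring.ring_hom (cohomology Y) (cohomology X)"
proof (rule ring_hom_memI)
  fix C assume "C \<in> carrier (cohomology Y)"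
  then show "pullback X F C \<in> carrier (cohomology X)"
    by (auto simp: carrier_cohomology pullback_coho_class [OF assms] pullback_cocycle [OF assms])
next
  fix C D assume "C \<in> carrier (cohomology Y)" "D \<in> carrier (cohomology Y)"
  then obtain f g where f: "f \<in> carrier (cocycle_ring Y)" "C = coho_class Y f"
    and g: "g \<in> carrier (cocycle_ring Y)" "D = coho_class Y g"
    by (auto simp: carrier_cohomology)
  have add: "(\<lambda>p s. f p s + g p s) \<in> carrier (cocycle_ring Y)"
    using f g by (simp add: cocycle_iff coboundary_add)
  show "pullback X F (C \<otimes>\<^bsub>cohomology Y\<^esub> D) = pullback X F C \<otimes>\<^bsub>cohomology X\<^esub> pullback X F D"
    using f g by (simp add: coho_class_mult pullback_coho_class [OF assms] cocycle_cup
        pullback_cocycle [OF assms] pullback_cup [OF assms])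
  show "pullback X F (C \<oplus>\<^bsub>cohomology Y\<^esub> D) = pullback X F C \<oplus>\<^bsub>cohomology X\<^esub> pullback X F D"
    using f g by (simp add: coho_class_add pullback_coho_class [OF assms] add
        pullback_cocycle [OF assms] pullback_cochain_add)
next
  show "pullback X F \<one>\<^bsub>cohomology Y\<^esub> = \<one>\<^bsub>cohomology X\<^esub>"
    by (simp add: coho_class_one pullback_coho_class [OF assms] cocycle_const pullback_const_cochain [OF assms])
qed

lemma pullback_cochain_cong:
  assumes "\<And>x. x \<in> topspace X \<Longrightarrow> F x = G x"
  shows "pullback_cochain X F f = pullback_cochain X G f"
  unfolding pullback_cochain_def fun_eq_iff by (metis simplex_map_eq assms)

lemma pullback_cong:
  "(\<And>x. x \<in> topspace X \<Longrightarrow> F x = G x) \<Longrightarrow> pullback X F C = pullback X G C"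
  unfolding pullback_def by (simp add: pullback_cochain_cong [of X F G])

lemma pullback_cochain_compose:
  assumes "continuous_map X Y F"
  shows "pullback_cochain X F (pullback_cochain Y G f) = pullback_cochain X (G \<circ> F) f"
  using singular_simplex_simplex_map [OF _ assms]
  by (simp add: pullback_cochain_def fun_eq_iff simplex_map_compose)

lemma pullback_compose:
  assumes "continuous_map X Y F" "continuous_map Y Z G" "C \<in> carrier (cohomology Z)"
  shows "pullback X F (pullback Y G C) = pullback X (G \<circ> F) C"
proof -
  obtain f where f: "f \<in> carrier (cocycle_ring Z)" "C = coho_class Z f"
    using assms(3) by (auto simp: carrier_cohomology)
  then show ?thesis
    by (simp add: pullback_coho_class [OF assms(2)] pullback_coho_class [OF assms(1)]
        pullback_coho_class [OF continuous_map_compose [OF assms(1,2)]] pullback_cocycle [OF assms(2)]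
        pullback_cochain_compose [OF assms(1)])
qed

section \<open>Reduced words and parabolic subgroups of the symmetric group\<close>

declare One_nat_def [simp del]

section \<open>Length as the number of inversions\<close>

definition inversions :: "nat \<Rightarrow> (nat \<Rightarrow> nat) \<Rightarrow> (nat \<times> nat) set" where
  "inversions n w = {(i, j). 1 \<le> i \<and> i < j \<and> j \<le> n \<and> w j < w i}"

lemma finite_inversions: "finite (inversions n w)"
  by (rule finite_subset [of _ "{1..n} \<times> {1..n}"]) (auto simp: inversions_def)

lemma simple_refl_apply:
  "simple_refl b x = (if x = b then Suc b else if x = Suc b then b else x)"
  by (simp add: simple_refl_def transpose_def)

lemma simple_refl_permutes: "b \<in> {1..n - 1} \<Longrightarrow> simple_refl b permutes {1..n}"
  unfolding simple_refl_def by (rule permutes_swap_id) auto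

lemma simple_refl_involution: "w \<circ> simple_refl b \<circ> simple_refl b = w"
  by (simp add: fun_eq_iff simple_refl_apply)

text \<open>Swapping the positions \<open>b\<close> and \<open>Suc b\<close> preserves the order of
  every other pair of positions. It thus carries the inversions of \<open>w\<close> injectively to
  those of the product, and the pair \<open>(b, Suc b)\<close> is the only new one.\<close>

lemma card_inversions_ascent:
  assumes "b \<in> {1..n - 1}" "w b < w (Suc b)"
  shows "card (inversions n (w \<circ> simple_refl b)) = Suc (card (inversions n w))"
proof -
  let ?s = "simple_refl b" and ?m = "map_prod (simple_refl b) (simple_refl b)"
  have inv: "?s (?s x) = x" for x
    by (simp add: simple_refl_apply)
  have ord: "?s x < ?s y" if "x < y" "(x, y) \<noteq> (b, Suc b)" for x y
    using that by (auto simp: simple_refl_apply)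
  have ran: "1 \<le> ?s x \<and> ?s x \<le> n" if "1 \<le> x" "x \<le> n" for x
    using that assms by (auto simp: simple_refl_apply)
  have ne: "(x, y) \<noteq> (b, Suc b)" if "w y < w x" for x y
    using that assms by auto
  have "inversions n (w \<circ> ?s) = insert (b, Suc b) (?m ` inversions n w)"
  proof (intro equalityI subsetI)
    fix z assume z: "z \<in> inversions n (w \<circ> ?s)"
    obtain x y where xy: "z = (x, y)" by fastforce
    show "z \<in> insert (b, Suc b) (?m ` inversions n w)"
    proof (cases "z = (b, Suc b)")
      case False
      then have "(?s x, ?s y) \<in> inversions n w"
        using z ord [of x y] ran [of x] ran [of y] by (auto simp: xy inversions_def)
      then have "?m (?s x, ?s y) \<in> ?m ` inversions n w" by (rule imageI)
      then show ?thesis by (simp add: inv xy)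
    qed simp
  next
    fix z assume "z \<in> insert (b, Suc b) (?m ` inversions n w)"
    moreover have "(b, Suc b) \<in> inversions n (w \<circ> ?s)"
      using assms by (auto simp: inversions_def simple_refl_apply)
    moreover have "(?s x, ?s y) \<in> inversions n (w \<circ> ?s)" if "(x, y) \<in> inversions n w" for x y
      using that ord [of x y] ran [of x] ran [of y] ne [of y x] by (auto simp: inversions_def inv)
    ultimately show "z \<in> inversions n (w \<circ> ?s)" by auto
  qed
  moreover have "(b, Suc b) \<notin> ?m ` inversions n w"
  proof
    assume "(b, Suc b) \<in> ?m ` inversions n w"
    then obtain x y where xy: "(x, y) \<in> inversions n w" "?s x = b" "?s y = Suc b" by auto
    then have "x = Suc b" "y = b" by (metis inv simple_refl_apply)+
    with xy(1) show False by (simp add: inversions_def)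
  qed
  moreover have "inj_on ?m (inversions n w)"
    by (rule inj_onI) (metis inv map_prod_simp prod.collapse prod.inject)
  ultimately show ?thesis
    by (simp add: finite_inversions card_image)
qed

lemma card_inversions_descent:
  assumes "b \<in> {1..n - 1}" "w (Suc b) < w b"
  shows "card (inversions n w) = Suc (card (inversions n (w \<circ> simple_refl b)))"
  using card_inversions_ascent [of b n "w \<circ> simple_refl b"] assms
  by (simp add: simple_refl_involution) (simp add: simple_refl_apply)

lemma word_prod_Nil [simp]: "word_prod [] = id"
  by (simp add: word_prod_def)

lemma word_prod_Cons: "word_prod (b # bs) = simple_refl b \<circ> word_prod bs"
  by (simp add: word_prod_def)

lemma word_prod_append: "word_prod (as @ bs) = word_prod as \<circ> word_prod bs"
  by (induction as) (simp_all add: word_prod_Cons comp_assoc)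

lemma word_prod_permutes: "set bs \<subseteq> {1..n - 1} \<Longrightarrow> word_prod bs permutes {1..n}"
proof (induction bs)
  case (Cons b bs)
  then show ?case
    unfolding word_prod_Cons by (intro permutes_compose simple_refl_permutes) auto
qed (simp add: permutes_id)

lemma permutes_neq: "w permutes S \<Longrightarrow> x \<noteq> y \<Longrightarrow> w x \<noteq> w y"
  by (metis permutes_inj injD)

lemma card_inversions_word:
  assumes "w permutes {1..n}" "set bs \<subseteq> {1..n - 1}"
  shows "card (inversions n (w \<circ> word_prod bs)) \<le> card (inversions n w) + length bs"
  using assms(2)
proof (induction bs rule: rev_induct)
  case (snoc b bs)
  let ?u = "w \<circ> word_prod bs"
  have u: "?u permutes {1..n}"
    using snoc.prems assms by (simp add: permutes_compose word_prod_permutes)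
  have "card (inversions n (?u \<circ> simple_refl b)) \<le> Suc (card (inversions n ?u))"
    using card_inversions_ascent [of b n ?u] card_inversions_descent [of b n ?u] snoc.prems
      permutes_neq [OF u, of b "Suc b"] by (cases "?u b < ?u (Suc b)") auto
  moreover have "w \<circ> word_prod (bs @ [b]) = ?u \<circ> simple_refl b"
    by (simp add: word_prod_append word_prod_Cons comp_assoc)
  moreover have "card (inversions n ?u) \<le> card (inversions n w) + length bs"
    using snoc by (metis le_sup_iff set_append)
  ultimately show ?case
    by (metis add_Suc_right length_append_singleton le_trans Suc_le_mono)
qed simp

lemma inversions_id: "inversions n id = {}"
  by (auto simp: inversions_def)

lemma strict_mono_permutes_id:
  fixes w :: "nat \<Rightarrow> nat"
  assumes w: "w permutes {1..n}" and mono: "\<And>i j. i \<in> {1..n} \<Longrightarrow> j \<in> {1..n} \<Longrightarrow> i < j \<Longrightarrow> w i < w j"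
  shows "w = id"
proof
  fix x
  show "w x = id x"
  proof (induction x rule: less_induct)
    case (less x)
    show ?case
    proof (cases "x \<in> {1..n}")
      case True
      obtain y where y: "w y = x" by (metis w permutes_surj surjD)
      then have "y \<in> {1..n}" using True w by (metis permutes_in_image)
      then have "\<not> x < y" "y \<noteq> x \<longrightarrow> \<not> y < x"
      proof -
        show "\<not> x < y"
        proof
          assume "x < y"
          then have "w x < x" using mono [of x y] True y \<open>y \<in> {1..n}\<close> by simp
          then have "w (w x) = w x" using less by simp
          then show False using permutes_neq [OF w, of "w x" x] \<open>w x < x\<close> by simp
        qed
        show "y \<noteq> x \<longrightarrow> \<not> y < x" using less [of y] y by auto
      qed
      then show ?thesis using y by auto
    next
      case False
      then show ?thesis using w by (simp add: permutes_not_in)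
    qed
  qed
qed

text \<open>Membership in the subgroup generated by the reflections in \<open>A\<close>, tested on
  values instead of words: each index outside \<open>A\<close> is a wall, and no point crosses it.
  Agreement with the generated subgroup is \<open>generate_parabolic\<close>.\<close>

definition parabolic :: "nat \<Rightarrow> nat set \<Rightarrow> (nat \<Rightarrow> nat) \<Rightarrow> bool" where
  "parabolic n A w \<longleftrightarrow> w permutes {1..n} \<and> (\<forall>k\<in>{1..n - 1} - A. \<forall>x\<le>k. w x \<le> k)"

lemma parabolic_id: "parabolic n A id"
  unfolding parabolic_def using permutes_id by simp

lemma parabolic_permutes: "parabolic n A w \<Longrightarrow> w permutes {1..n}"
  by (simp add: parabolic_def)

lemma parabolic_le: "parabolic n A w \<Longrightarrow> k \<in> {1..n - 1} - A \<Longrightarrow> x \<le> k \<Longrightarrow> w x \<le> k"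
  by (simp add: parabolic_def)

text \<open>An injective self-map of the finite set \<open>{..k}\<close> is onto, so nothing from
  above the wall can land below it.\<close>

lemma parabolic_gt:
  assumes "parabolic n A w" "k \<in> {1..n - 1} - A" "k < x" shows "k < w x"
proof -
  have "w ` {..k} \<subseteq> {..k}" using assms by (auto simp: parabolic_def)
  moreover have "inj w" using assms(1) by (meson parabolic_permutes permutes_inj)
  ultimately have "w ` {..k} = {..k}"
    by (meson endo_inj_surj finite_atMost inj_on_subset subset_UNIV)
  then have "w x \<notin> {..k}" using assms(3) \<open>inj w\<close> by (metis atMost_iff inj_image_mem_iff leD)
  then show ?thesis by simp
qed

lemma parabolic_mono: "parabolic n A w \<Longrightarrow> A \<subseteq> B \<Longrightarrow> parabolic n B w"
  by (auto simp: parabolic_def)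

lemma parabolic_comp: "parabolic n A v \<Longrightarrow> parabolic n A w \<Longrightarrow> parabolic n A (v \<circ> w)"
  by (auto simp: parabolic_def intro: permutes_compose)

lemma parabolic_simple: "b \<in> A \<Longrightarrow> A \<subseteq> {1..n - 1} \<Longrightarrow> parabolic n A (simple_refl b)"
  by (force simp: parabolic_def simple_refl_apply le_less intro!: simple_refl_permutes)

lemma parabolic_word: "set bs \<subseteq> A \<Longrightarrow> A \<subseteq> {1..n - 1} \<Longrightarrow> parabolic n A (word_prod bs)"
proof (induction bs)
  case (Cons b bs)
  then show ?case
    unfolding word_prod_Cons by (intro parabolic_comp parabolic_simple) auto
qed (simp add: parabolic_id)

text \<open>Sorting by adjacent swaps removes one inversion at a time. Each descent used is a letter
  of \<open>A\<close>, since a wall at \<open>b\<close> would force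
  \<open>w b \<le> b < w (Suc b)\<close>. So the shortest words of an element of the subgroup can be
  found inside it.\<close>

lemma parabolic_ex_word:
  assumes "parabolic n A w" "A \<subseteq> {1..n - 1}"
  shows "\<exists>bs. set bs \<subseteq> A \<and> length bs = card (inversions n w) \<and> word_prod bs = w"
  using assms(1)
proof (induction "card (inversions n w)" arbitrary: w)
  case 0
  then have "inversions n w = {}" by (simp add: finite_inversions)
  then have "w i < w j" if "i \<in> {1..n}" "j \<in> {1..n}" "i < j" for i j
    using that permutes_neq [OF parabolic_permutes [OF 0(2)], of i j]
    by (force simp: inversions_def)
  then have "w = id"
    using strict_mono_permutes_id [OF parabolic_permutes [OF 0(2)]] by blast
  then show ?case using 0 by (intro exI [of _ "[]"]) simp
next
  case (Suc m)
  have w: "w permutes {1..n}" using Suc.prems by (rule parabolic_permutes)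
  have "\<exists>b\<in>{1..n - 1}. w (Suc b) < w b"
  proof (rule ccontr)
    assume none: "\<not> ?thesis"
    have "w i < w j" if "1 \<le> i" "i < j" "j \<le> n" for i j
      using that(2,1,3)
    proof (induction rule: less_Suc_induct)
      case (1 i)
      then show ?case using none permutes_neq [OF w, of i "Suc i"] by force
    qed simp
    then have "inversions n w = {}" by (force simp: inversions_def)
    then show False using Suc.hyps(2) by simp
  qed
  then obtain b where b: "b \<in> {1..n - 1}" "w (Suc b) < w b" by blast
  have "b \<in> A"
  proof (rule ccontr)
    assume "b \<notin> A"
    then have "w b \<le> b" "b < w (Suc b)"
      using parabolic_le [OF Suc.prems, of b b] parabolic_gt [OF Suc.prems, of b "Suc b"] b by auto
    then show False using b by simp
  qed
  let ?u = "w \<circ> simple_refl b"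
  have "parabolic n A ?u"
    using Suc.prems \<open>b \<in> A\<close> assms(2) by (intro parabolic_comp parabolic_simple)
  moreover have card: "Suc (card (inversions n ?u)) = Suc m"
    using card_inversions_descent [of b n w] b Suc.hyps(2) by simp
  ultimately obtain bs where bs: "set bs \<subseteq> A" "length bs = card (inversions n ?u)" "word_prod bs = ?u"
    using Suc.hyps(1) [of ?u] by auto
  then show ?case
    using \<open>b \<in> A\<close> card Suc.hyps(2)
    by (intro exI [of _ "bs @ [b]"]) (simp add: word_prod_append word_prod_Cons simple_refl_involution)
qed

lemma cox_length_eq:
  assumes "w permutes {1..n}" shows "cox_length n w = card (inversions n w)"
  unfolding cox_length_def
proof (rule Least_equality)
  \<comment> \<open>With all letters allowed there are no walls, so this is just the
    hypothesis.\<close>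
  have "parabolic n {1..n - 1} w" using assms by (simp add: parabolic_def)
  from parabolic_ex_word [OF this]
  show "\<exists>bs. set bs \<subseteq> {1..n - 1} \<and> length bs = card (inversions n w) \<and> word_prod bs = w"
    by auto
next
  fix k assume "\<exists>bs. set bs \<subseteq> {1..n - 1} \<and> length bs = k \<and> word_prod bs = w"
  then show "card (inversions n w) \<le> k"
    using card_inversions_word [of id n] by (auto simp: permutes_id inversions_id)
qed

lemma cox_length_word: "set bs \<subseteq> {1..n - 1} \<Longrightarrow> cox_length n (word_prod bs) \<le> length bs"
  using card_inversions_word [of id n bs]
  by (simp add: cox_length_eq word_prod_permutes permutes_id inversions_id)

text \<open>A descent at this letter would lose an inversion, and the remaining letters can add at
  most one each, so the product could not reach the required length. This is the source of the
  positivity of the factors in Billey's formula.\<close>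

lemma reduced_word_ascent:
  assumes bs: "reduced_word n w bs" and i: "i < length bs"
  shows "word_prod (take i bs) (bs ! i) < word_prod (take i bs) (Suc (bs ! i))"
proof (rule ccontr)
  let ?u = "word_prod (take i bs)" and ?b = "bs ! i" and ?r = "word_prod (drop (Suc i) bs)"
  have set: "set bs \<subseteq> {1..n - 1}" and w: "word_prod bs = w" and len: "length bs = cox_length n w"
    using bs by (auto simp: reduced_word_def)
  have b: "?b \<in> {1..n - 1}" using i set nth_mem by blast
  have u: "?u permutes {1..n}"
    using set set_take_subset [of i bs] by (intro word_prod_permutes) auto
  assume "\<not> ?u ?b < ?u (Suc ?b)"
  then have "?u (Suc ?b) < ?u ?b" using permutes_neq [OF u, of ?b "Suc ?b"] by simp
  then have 1: "card (inversions n ?u) = Suc (card (inversions n (?u \<circ> simple_refl ?b)))"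
    by (rule card_inversions_descent [OF b])
  have "cox_length n ?u \<le> i"
    using cox_length_word [of "take i bs" n] set set_take_subset [of i bs] i by auto
  then have 2: "card (inversions n ?u) \<le> i" using u by (simp add: cox_length_eq)
  have "bs = take i bs @ ?b # drop (Suc i) bs" using i by (rule id_take_nth_drop)
  then have weq: "w = ?u \<circ> simple_refl ?b \<circ> ?r"
    using w by (metis word_prod_append word_prod_Cons comp_assoc)
  have 3: "card (inversions n (?u \<circ> simple_refl ?b \<circ> ?r)) \<le>
      card (inversions n (?u \<circ> simple_refl ?b)) + (length bs - Suc i)"
    using card_inversions_word [of "?u \<circ> simple_refl ?b" n "drop (Suc i) bs"] set
      set_drop_subset [of "Suc i" bs] permutes_compose [OF simple_refl_permutes [OF b] u] by auto
  have "w permutes {1..n}" using word_prod_permutes [OF set] w by simp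
  then have "length bs = card (inversions n w)" using len cox_length_eq by simp
  with 1 2 3 [folded weq] i show False by linarith
qed

subsection \<open>Longest elements\<close>

lemma generate_parabolic:
  assumes A: "A \<subseteq> {1..n - 1}"
  shows "w \<in> generate (sym_group n) (simple_refl ` A) \<longleftrightarrow> parabolic n A w"
proof
  interpret group "sym_group n" by (rule sym_group_is_group)
  show "parabolic n A w" if "w \<in> generate (sym_group n) (simple_refl ` A)"
    using that
  proof induction
    case one
    show ?case unfolding sym_group_one by (rule parabolic_id)
  next
    case (incl h)
    then show ?case using A by (auto intro: parabolic_simple)
  next
    case (inv h)
    then obtain b where b: "b \<in> A" "h = simple_refl b" by blast
    moreover have "inv\<^bsub>sym_group n\<^esub> h = h"
    proof (rule inv_equality)
      show "h \<otimes>\<^bsub>sym_group n\<^esub> h = \<one>\<^bsub>sym_group n\<^esub>"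
        using b simple_refl_involution [of id b] by (metis id_comp sym_group_mult sym_group_one)
      show "h \<in> carrier (sym_group n)" "h \<in> carrier (sym_group n)"
        using b A simple_refl_permutes [of b n] by (auto simp: sym_group_carrier)
    qed
    ultimately show ?case using A by (simp add: parabolic_simple)
  next
    case (eng h1 h2)
    then show ?case unfolding sym_group_mult by (intro parabolic_comp)
  qed
  assume "parabolic n A w"
  then obtain bs where bs: "set bs \<subseteq> A" "word_prod bs = w"
    using parabolic_ex_word [OF _ A] by blast
  from bs(1) have "word_prod bs \<in> generate (sym_group n) (simple_refl ` A)"
  proof (induction bs)
    case Nil
    show ?case by (metis generate.one sym_group_one word_prod_Nil)
  next
    case (Cons b bs)
    then have "simple_refl b \<otimes>\<^bsub>sym_group n\<^esub> word_prod bs \<in> generate (sym_group n) (simple_refl ` A)"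
      by (intro generate.eng generate.incl [of "simple_refl b"]) auto
    then show ?case unfolding sym_group_mult word_prod_Cons .
  qed
  then show "w \<in> generate (sym_group n) (simple_refl ` A)" by (simp add: bs)
qed

lemma w_long_props:
  assumes A: "A \<subseteq> {1..n - 1}"
  shows "parabolic n A (w_long n A)"
    and "parabolic n A u \<Longrightarrow> cox_length n u \<le> cox_length n (w_long n A)"
proof -
  \<comment> \<open>A crude uniform bound, which guarantees that the maximum behind
    \<open>arg_max\<close> is attained.\<close>
  have "cox_length n u < Suc (card ({1..n} \<times> {1..n}))" if "parabolic n A u" for u
    using that card_mono [of "{1..n} \<times> {1..n}" "inversions n u"]
    by (force simp: cox_length_eq parabolic_permutes inversions_def)
  moreover note parabolic_id
  ultimately have "parabolic n A (arg_max (cox_length n) (parabolic n A)) \<and>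
      (\<forall>u. parabolic n A u \<longrightarrow> cox_length n u \<le> cox_length n (arg_max (cox_length n) (parabolic n A)))"
    by (intro arg_max_nat_lemma) auto
  moreover have "w_long n A = arg_max (cox_length n) (parabolic n A)"
    unfolding w_long_def by (simp add: generate_parabolic [OF A])
  ultimately show "parabolic n A (w_long n A)"
    and "parabolic n A u \<Longrightarrow> cox_length n u \<le> cox_length n (w_long n A)" by auto
qed

lemma parabolic_ascent_longer:
  assumes "A \<subseteq> {1..n - 1}" "parabolic n A w" "b \<in> A" "w b < w (Suc b)"
  shows "parabolic n A (w \<circ> simple_refl b)" "cox_length n (w \<circ> simple_refl b) = Suc (cox_length n w)"
proof -
  show *: "parabolic n A (w \<circ> simple_refl b)"
    using assms by (intro parabolic_comp parabolic_simple)
  show "cox_length n (w \<circ> simple_refl b) = Suc (cox_length n w)"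
    using assms card_inversions_ascent [of b n w] cox_length_eq [OF parabolic_permutes [OF *]]
      cox_length_eq [OF parabolic_permutes [OF assms(2)]] by (metis subsetD)
qed

lemma w_long_descent:
  assumes A: "A \<subseteq> {1..n - 1}" and b: "b \<in> A"
  shows "w_long n A (Suc b) < w_long n A b"
proof (rule ccontr)
  assume "\<not> ?thesis"
  then have "w_long n A b < w_long n A (Suc b)"
    using permutes_neq [OF parabolic_permutes [OF w_long_props(1) [OF A]], of b "Suc b"] by simp
  from parabolic_ascent_longer [OF A w_long_props(1) [OF A] b this]
  show False using w_long_props(2) [OF A] by (metis Suc_n_not_le_n)
qed

lemma descents_decreasing:
  assumes "\<And>b. b \<in> A \<Longrightarrow> w (Suc b) < (w b :: nat)" "i < j" "{i..<j} \<subseteq> A"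
  shows "w j < w i"
  using assms(2,3)
proof (induction rule: less_Suc_induct)
  case (1 i)
  then show ?case using assms(1) by auto
next
  case (2 i j k)
  have "{i..<j} \<subseteq> {i..<k}" "{j..<k} \<subseteq> {i..<k}" using 2 by auto
  then show ?case using 2 by (meson order.strict_trans subset_trans)
qed

text \<open>Positions \<open>i < j\<close> lie in one block of \<open>A\<close> when
  \<open>{i..<j} \<subseteq> A\<close>; otherwise some wall separates them. This dichotomy drives
  the arguments about \<open>w_long\<close> below.\<close>

lemma not_same_block:
  fixes i j n :: nat
  assumes "1 \<le> i" "j \<le> n" "\<not> {i..<j} \<subseteq> A"
  obtains k where "k \<in> {1..n - 1} - A" "i \<le> k" "k < j"
proof -
  obtain k where "k \<in> {i..<j}" "k \<notin> A" using assms by blast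
  moreover from this have "k \<in> {1..n - 1}" using assms(1,2) by auto
  ultimately show ?thesis using that [of k] by simp
qed

text \<open>The quotient \<open>?v\<close> is increasing, hence the identity: across a wall both
  permutations keep the order, and inside a block both reverse it. So \<open>w_long\<close> is the
  only element of the subgroup with a descent at every letter of \<open>A\<close>.\<close>

lemma parabolic_descents_unique:
  assumes u: "parabolic n A u" "\<And>b. b \<in> A \<Longrightarrow> u (Suc b) < u b"
    and w: "parabolic n A w" "\<And>b. b \<in> A \<Longrightarrow> w (Suc b) < w b"
  shows "u = w"
proof -
  have pu: "u permutes {1..n}" and pw: "w permutes {1..n}"
    using u w by (auto simp: parabolic_permutes)
  let ?v = "inv' u \<circ> w"
  have uv: "u (?v x) = w x" for x using pu by (simp add: permutes_inverses)
  have v: "?v permutes {1..n}" using pu pw by (intro permutes_compose permutes_inv)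
  have "?v i < ?v j" if i: "i \<in> {1..n}" and j: "j \<in> {1..n}" and "i < j" for i j
  proof (rule ccontr)
    assume "\<not> ?v i < ?v j"
    then have less: "?v j < ?v i" using permutes_neq [OF v, of i j] \<open>i < j\<close> by linarith
    have vi: "?v i \<in> {1..n}" "?v j \<in> {1..n}" using permutes_in_image [OF v] i j by auto
    show False
    proof (cases "{i..<j} \<subseteq> A")
      case True
      have wji: "w j < w i" by (rule descents_decreasing [where w = w and A = A, OF w(2) \<open>i < j\<close> True])
      have "\<not> {?v j..<?v i} \<subseteq> A"
        using descents_decreasing [where w = u and A = A, OF u(2) less] wji by (metis uv less_asym)
      then obtain k where k: "k \<in> {1..n - 1} - A" "?v j \<le> k" "k < ?v i"
        using not_same_block [of "?v j" "?v i" n A] vi by auto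
      then have "w j \<le> k" "k < w i"
        using parabolic_le [OF u(1) k(1,2)] parabolic_gt [OF u(1) k(1,3)] by (simp_all only: uv)
      then have "j \<le> k" "k < i"
        using parabolic_gt [OF w(1) k(1), of j] parabolic_le [OF w(1) k(1), of i] by linarith+
      then show False using \<open>i < j\<close> by simp
    next
      case False
      then obtain k where k: "k \<in> {1..n - 1} - A" "i \<le> k" "k < j"
        using not_same_block [of i j n A] i j by auto
      then have "w i \<le> k" "k < w j"
        using parabolic_le [OF w(1) k(1,2)] parabolic_gt [OF w(1) k(1,3)] by simp_all
      then have "?v i \<le> k" "k < ?v j"
        using parabolic_gt [OF u(1) k(1), of "?v i"] parabolic_le [OF u(1) k(1), of "?v j"]
        unfolding uv by linarith+
      then show False using less by simp
    qed
  qed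
  then have "?v = id" by (intro strict_mono_permutes_id [OF v])
  then show ?thesis using uv by (metis id_apply ext)
qed

text \<open>As long as some letter of \<open>A\<close> is an ascent, appending it lengthens the
  element by one; the process can only stop at \<open>w_long\<close>. Hence a reduced word of
  \<open>v\<close> extends to a reduced word of \<open>w_long\<close>.\<close>

lemma parabolic_extend:
  assumes A: "A \<subseteq> {1..n - 1}" and "parabolic n A v"
  shows "\<exists>bs. set bs \<subseteq> A \<and> v \<circ> word_prod bs = w_long n A \<and>
      cox_length n (w_long n A) = cox_length n v + length bs"
  using assms(2)
proof (induction "cox_length n (w_long n A) - cox_length n v" arbitrary: v rule: less_induct)
  case less
  show ?case
  proof (cases "\<exists>b\<in>A. v b < v (Suc b)")
    case True
    then obtain b where b: "b \<in> A" "v b < v (Suc b)" by blast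
    note longer = parabolic_ascent_longer [OF A less.prems b]
    have "cox_length n (v \<circ> simple_refl b) \<le> cox_length n (w_long n A)"
      using w_long_props(2) [OF A longer(1)] .
    then obtain bs where "set bs \<subseteq> A" "v \<circ> simple_refl b \<circ> word_prod bs = w_long n A"
      "cox_length n (w_long n A) = cox_length n (v \<circ> simple_refl b) + length bs"
      using less.hyps [OF _ longer(1)] longer(2) by (metis Suc_le_lessD diff_less_mono2 lessI)
    then show ?thesis
      using b longer(2) by (intro exI [of _ "b # bs"]) (simp add: word_prod_Cons comp_assoc)
  next
    case False
    then have "v (Suc b) < v b" if "b \<in> A" for b
      using that permutes_neq [OF parabolic_permutes [OF less.prems], of b "Suc b"] by force
    then have "v = w_long n A"
      using less.prems w_long_props(1) [OF A] w_long_descent [OF A]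
      by (intro parabolic_descents_unique [of n A]) auto
    then show ?thesis by (intro exI [of _ "[]"]) simp
  qed
qed

text \<open>This is the Peterson condition on coordinate flags: the nilpotent matrix lowers the
  index of a basis vector by one, and the new vector must already appear one step later in the flag.
  If it came later still, either the block would hold another value strictly between the two, or a
  wall would put the smaller value above the larger one.\<close>

lemma w_long_prev:
  assumes A: "A \<subseteq> {1..n - 1}" and j: "j \<in> {1..n}" and two: "2 \<le> w_long n A j"
  shows "\<exists>k\<in>{1..n}. k \<le> Suc j \<and> w_long n A k = w_long n A j - 1"
proof -
  let ?w = "w_long n A"
  have par: "parabolic n A ?w" by (rule w_long_props(1) [OF A])
  have w: "?w permutes {1..n}" using par by (rule parabolic_permutes)
  obtain k where k: "?w k = ?w j - 1" by (metis w permutes_surj surjD)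
  have "?w j \<in> {1..n}" using permutes_in_image [OF w] j by simp
  then have "?w k \<in> {1..n}" using k two by auto
  then have kn: "k \<in> {1..n}" using permutes_in_image [OF w] by simp
  have "k \<le> Suc j"
  proof (rule ccontr)
    assume "\<not> k \<le> Suc j"
    then have less: "Suc j < k" by simp
    show False
    proof (cases "{j..<k} \<subseteq> A")
      case True
      have "{Suc j..<k} \<subseteq> A" using True by auto
      then have "?w k < ?w (Suc j)" using descents_decreasing [of A ?w, OF w_long_descent [OF A] less] by simp
      moreover have "?w (Suc j) < ?w j" using True less by (intro w_long_descent [OF A]) auto
      ultimately show False using k by simp
    next
      case False
      then obtain m where m: "m \<in> {1..n - 1} - A" "j \<le> m" "m < k"
        using not_same_block [of j k n A] j kn by auto
      then have "?w j \<le> m" "m < ?w k"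
        using parabolic_le [OF par m(1,2)] parabolic_gt [OF par m(1,3)] by simp_all
      then show False using k by simp
    qed
  qed
  then show ?thesis using k kn by blast
qed

lemma bruhat_le_cox_length: "bruhat_le n u v \<Longrightarrow> cox_length n u \<le> cox_length n v"
  unfolding bruhat_le_def by (induction rule: rtranclp_induct) auto

text \<open>A letter \<open>b\<close> of \<open>A\<close> outside \<open>B\<close> is a wall for
  \<open>w_long n B\<close>, hence an ascent, so a longer element exists in the subgroup of
  \<open>A\<close>. Bruhat order is used only through its monotonicity in length.\<close>

lemma w_long_psubset:
  assumes A: "A \<subseteq> {1..n - 1}" and "B \<subset> A"
  shows "\<not> bruhat_le n (w_long n A) (w_long n B)"
proof -
  obtain b where b: "b \<in> A" "b \<notin> B" using assms by blast
  have par: "parabolic n B (w_long n B)" using assms by (intro w_long_props(1)) auto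
  have "b \<in> {1..n - 1} - B" using A b by auto
  then have "w_long n B b \<le> b" "b < w_long n B (Suc b)"
    using parabolic_le [OF par, of b b] parabolic_gt [OF par, of b "Suc b"] by simp_all
  then have "w_long n B b < w_long n B (Suc b)" by simp
  from parabolic_ascent_longer [OF A _ b(1) this] par w_long_props(2) [OF A] assms(2)
  have "cox_length n (w_long n B) < cox_length n (w_long n A)"
    by (metis Suc_le_lessD parabolic_mono psubset_imp_subset)
  then show ?thesis using bruhat_le_cox_length by (metis leD)
qed

declare One_nat_def [simp]

section \<open>Maps of Borel spaces\<close>

text \<open>The closure properties shared by the torus and the circle, so that the Borel
  construction is treated once for both.\<close>

definition diagonal_group :: "nat \<Rightarrow> complex mat set \<Rightarrow> bool" where
  "diagonal_group n K \<longleftrightarrow> 1\<^sub>m n \<in> K \<and> K \<subseteq> torus n \<and> (\<forall>h\<in>K. \<forall>k\<in>K. h * k \<in> K) \<and>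
     (\<forall>k\<in>K. \<exists>h\<in>K. h * k = 1\<^sub>m n)"

lemma diagonal_group_torus: "diagonal_group n (torus n)"
  unfolding diagonal_group_def
proof (intro conjI ballI)
  show "1\<^sub>m n \<in> torus n"
    unfolding torus_def by (rule CollectI, rule exI [of _ "\<lambda>i. 1"]) simp
  show "h * k \<in> torus n" if hk: "h \<in> torus n" "k \<in> torus n" for h k
  proof -
    obtain c d where "h = mat_diag n c" "k = mat_diag n d" "\<forall>i<n. cmod (c i) = 1" "\<forall>i<n. cmod (d i) = 1"
      using hk unfolding torus_def by blast
    then show ?thesis
      unfolding torus_def by (intro CollectI exI [of _ "\<lambda>i. c i * d i"]) (simp add: norm_mult)
  qed
  show "\<exists>h\<in>torus n. h * k = 1\<^sub>m n" if hk: "k \<in> torus n" for k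
  proof -
    obtain d where d: "k = mat_diag n d" "\<forall>i<n. cmod (d i) = 1"
      using hk unfolding torus_def by blast
    have "d i \<noteq> 0" if "i < n" for i using d(2) that by auto
    then have "mat_diag n (\<lambda>i. inverse (d i)) * k = 1\<^sub>m n"
      unfolding d(1) mat_diag_diag by (intro eq_matI) (auto simp: mat_diag_def)
    moreover have "mat_diag n (\<lambda>i. inverse (d i)) \<in> torus n"
      unfolding torus_def using d(2)
      by (intro CollectI exI [of _ "\<lambda>i. inverse (d i)"]) (simp add: norm_inverse)
    ultimately show ?thesis by blast
  qed
qed simp

lemma diagonal_group_circle: "diagonal_group n (circle n)"
  unfolding diagonal_group_def
proof (intro conjI ballI)
  show "1\<^sub>m n \<in> circle n"
    unfolding circle_def by (rule CollectI, rule exI [of _ 1]) simp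
  show "circle n \<subseteq> torus n"
    unfolding circle_def torus_def by (auto simp: norm_power)
  show "h * k \<in> circle n" if hk: "h \<in> circle n" "k \<in> circle n" for h k
  proof -
    obtain x y where "h = mat_diag n (\<lambda>i. x ^ (n - i))" "k = mat_diag n (\<lambda>i. y ^ (n - i))"
      "cmod x = 1" "cmod y = 1"
      using hk unfolding circle_def by blast
    then show ?thesis
      unfolding circle_def by (intro CollectI exI [of _ "x * y"]) (simp add: norm_mult power_mult_distrib)
  qed
  show "\<exists>h\<in>circle n. h * k = 1\<^sub>m n" if hk: "k \<in> circle n" for k
  proof -
    obtain x where x: "k = mat_diag n (\<lambda>i. x ^ (n - i))" "cmod x = 1"
      using hk unfolding circle_def by blast
    then have "x \<noteq> 0" by auto
    then have "mat_diag n (\<lambda>i. inverse x ^ (n - i)) * k = 1\<^sub>m n"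
      unfolding x(1) mat_diag_diag
      by (simp add: power_mult_distrib [symmetric])
    moreover have "mat_diag n (\<lambda>i. inverse x ^ (n - i)) \<in> circle n"
      unfolding circle_def using x(2)
      by (intro CollectI exI [of _ "inverse x"]) (simp add: norm_inverse)
    ultimately show ?thesis by blast
  qed
qed

lemma diagonal_group_translate:
  assumes K: "diagonal_group n K" and k: "k \<in> K"
  shows "(\<lambda>h. h * k) ` K = K"
proof (intro equalityI subsetI)
  fix h assume h: "h \<in> K"
  obtain k' where k': "k' \<in> K" "k' * k = 1\<^sub>m n" using K k unfolding diagonal_group_def by blast
  have dims: "h \<in> carrier_mat n n" "k' \<in> carrier_mat n n" "k \<in> carrier_mat n n"
    using K h k k' unfolding diagonal_group_def torus_def by auto
  then have "h = (h * k') * k" using k' by (simp add: assoc_mult_mat)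
  moreover have "h * k' \<in> K" using K h k' unfolding diagonal_group_def by blast
  ultimately show "h \<in> (\<lambda>h. h * k) ` K" by blast
qed (use K k in \<open>auto simp: diagonal_group_def\<close>)

lemma torusD: "k \<in> torus n \<Longrightarrow> k \<in> carrier_mat n n \<and> (\<forall>i<n. cmod (k $$ (i, i)) = 1)"
  by (auto simp: torus_def mat_diag_def)

lemma ET_act_mult:
  assumes "h \<in> torus n" "k \<in> torus n"
  shows "ET_act (h * k) e = ET_act h (ET_act k e)"
proof -
  obtain c d where "h = mat_diag n c" "k = mat_diag n d"
    using assms unfolding torus_def by blast
  then show ?thesis by (simp add: ET_act_def fun_eq_iff) (simp add: mat_diag_def)
qed

text \<open>Stated relative to a set because \<open>left_act\<close> is compatible with products
  only on sets of matrices of the right size.\<close>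

definition acts_on :: "complex mat set \<Rightarrow> (complex mat \<Rightarrow> 'a \<Rightarrow> 'a) \<Rightarrow> 'a set \<Rightarrow> bool" where
  "acts_on K act S \<longleftrightarrow> (\<forall>h\<in>K. \<forall>k\<in>K. \<forall>x\<in>S. act (h * k) x = act h (act k x))"

lemma acts_on_trivial [simp]: "acts_on K (\<lambda>k x. x) S"
  by (simp add: acts_on_def)

lemma borel_orbit_act:
  assumes K: "diagonal_group n K" "acts_on K act S" and k: "k \<in> K" and x: "x \<in> S"
  shows "borel_orbit K act (ET_act k e, act k x) = borel_orbit K act (e, x)"
proof -
  have "borel_orbit K act (ET_act k e, act k x) = (\<lambda>h. (ET_act h (ET_act k e), act h (act k x))) ` K"
    by (auto simp: borel_orbit_def)
  also have "\<dots> = (\<lambda>h. (ET_act (h * k) e, act (h * k) x)) ` K"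
    using K k x unfolding acts_on_def diagonal_group_def
    by (intro image_cong refl) (auto simp: ET_act_mult [of _ n] subset_iff)
  also have "\<dots> = (\<lambda>h. (ET_act h e, act h x)) ` ((\<lambda>h. h * k) ` K)"
    by (simp add: image_image)
  also have "\<dots> = borel_orbit K act (e, x)"
    unfolding diagonal_group_translate [OF K(1) k] borel_orbit_def by auto
  finally show ?thesis .
qed

text \<open>\<open>borel_map\<close> takes the union of the orbits of the images of all
  representatives. Equivariance makes them one orbit, so any representative computes the
  value.\<close>

lemma borel_map_orbit:
  assumes K: "diagonal_group n K'" "acts_on K' act' S'" "K \<subseteq> K'" "K \<noteq> {}"
    and F: "\<And>k. k \<in> K \<Longrightarrow> F (act k x) = act' k (F x)" "F x \<in> S'"
  shows "borel_map K' act' F (borel_orbit K act (e, x)) = borel_orbit K' act' (e, F x)"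
proof -
  have "borel_map K' act' F (borel_orbit K act (e, x)) =
      (\<Union>k\<in>K. borel_orbit K' act' (ET_act k e, act' k (F x)))"
    unfolding borel_map_def borel_orbit_def [of K act] by (auto simp: F(1))
  also have "\<dots> = borel_orbit K' act' (e, F x)"
    using K F(2) by (auto simp: borel_orbit_act [OF K(1,2)] subset_iff)
  finally show ?thesis .
qed

lemma topspace_borel_space:
  "topspace (borel_space n K act X) = borel_orbit K act ` (topspace (ET n) \<times> topspace X)"
  unfolding borel_space_def
  using quotient_imp_surjective_map [OF quotient_map_quotient_topology [of "prod_topology (ET n) X" "borel_orbit K act"]]
  by simp

lemma continuous_borel_map:
  assumes K: "diagonal_group n K'" "acts_on K' act' (topspace Y)" "K \<subseteq> K'" "K \<noteq> {}"
    and cont: "continuous_map X Y F"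
    and F: "\<And>k x. k \<in> K \<Longrightarrow> x \<in> topspace X \<Longrightarrow> F (act k x) = act' k (F x)"
  shows "continuous_map (borel_space n K act X) (borel_space n K' act' Y) (borel_map K' act' F)"
  unfolding borel_space_def [of n K]
proof (rule continuous_compose_quotient_map [OF quotient_map_quotient_topology])
  let ?G = "\<lambda>z. (fst z, F (snd z))"
  have "continuous_map (prod_topology (ET n) X) (prod_topology (ET n) Y) ?G"
    using continuous_map_compose [OF continuous_map_snd cont, of "ET n"]
    by (intro continuous_map_pairedI continuous_map_fst) (simp add: o_def)
  then have "continuous_map (prod_topology (ET n) X) (borel_space n K' act' Y) (borel_orbit K' act' \<circ> ?G)"
    unfolding borel_space_def
    by (rule continuous_map_compose [OF _ quotient_imp_continuous_map [OF quotient_map_quotient_topology]])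
  moreover have "(borel_orbit K' act' \<circ> ?G) z = (borel_map K' act' F \<circ> borel_orbit K act) z"
    if "z \<in> topspace (prod_topology (ET n) X)" for z
  proof -
    obtain e x where z: "z = (e, x)" by fastforce
    then have x: "x \<in> topspace X" using that by simp
    then have "F x \<in> topspace Y" using cont by (meson continuous_map_image_subset_topspace image_subset_iff)
    then show ?thesis
      unfolding z using borel_map_orbit [OF K(1,2,3,4), where F = F and act = act and x = x] F x by simp
  qed
  ultimately show "continuous_map (prod_topology (ET n) X) (borel_space n K' act' Y)
      (borel_map K' act' F \<circ> borel_orbit K act)"
    by (rule continuous_map_eq)
qed

lemma continuous_orbit_pt: "continuous_map (ET n) (B_pt n K) (\<lambda>e. borel_orbit K (\<lambda>k x. x) (e, ()))"
proof -
  have "continuous_map (ET n) (prod_topology (ET n) (discrete_topology {()})) (\<lambda>e. (e, ()))"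
    by (intro continuous_map_pairedI) (simp_all add: continuous_map_const)
  from continuous_map_compose [OF this quotient_imp_continuous_map [OF quotient_map_quotient_topology]]
  show ?thesis by (simp add: borel_space_def o_def)
qed

section \<open>Permutation flags\<close>

lemma GL_iff:
  "g \<in> GL n \<longleftrightarrow> g \<in> carrier_mat n n \<and> (\<exists>h\<in>carrier_mat n n. g * h = 1\<^sub>m n \<and> h * g = 1\<^sub>m n)"
proof
  assume "g \<in> GL n"
  then obtain h where g: "g \<in> carrier_mat n n" and h: "g * h = 1\<^sub>m n" "h * g = 1\<^sub>m (dim_row h)"
    unfolding GL_def invertible_mat_def inverts_mat_def by auto
  then have "dim_col h = n" "dim_row h = n"
    by (metis carrier_matD(2) index_mult_mat(3) index_one_mat(3))+
  then show "g \<in> carrier_mat n n \<and> (\<exists>h\<in>carrier_mat n n. g * h = 1\<^sub>m n \<and> h * g = 1\<^sub>m n)"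
    using g h by auto
next
  assume "g \<in> carrier_mat n n \<and> (\<exists>h\<in>carrier_mat n n. g * h = 1\<^sub>m n \<and> h * g = 1\<^sub>m n)"
  then show "g \<in> GL n"
    unfolding GL_def invertible_mat_def inverts_mat_def by (auto simp: square_mat.simps)
qed

lemma GL_carrier: "g \<in> GL n \<Longrightarrow> g \<in> carrier_mat n n"
  by (simp add: GL_def)

lemma GL_mult:
  assumes "g \<in> GL n" "h \<in> GL n" shows "g * h \<in> GL n"
proof -
  obtain g' h' where *: "g' \<in> carrier_mat n n" "g * g' = 1\<^sub>m n" "g' * g = 1\<^sub>m n"
    "h' \<in> carrier_mat n n" "h * h' = 1\<^sub>m n" "h' * h = 1\<^sub>m n"
    using assms by (auto simp: GL_iff)
  have gh: "g \<in> carrier_mat n n" "h \<in> carrier_mat n n" using assms by (auto simp: GL_carrier)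
  have cancel: "(a * b) * (b' * a') = 1\<^sub>m n"
    if "a \<in> carrier_mat n n" "b \<in> carrier_mat n n" "b' \<in> carrier_mat n n" "a' \<in> carrier_mat n n"
      "b * b' = 1\<^sub>m n" "a * a' = 1\<^sub>m n" for a b b' a' :: "complex mat"
  proof -
    have "(a * b) * (b' * a') = a * (b * (b' * a'))" using that(1-4) by (simp add: assoc_mult_mat [of _ n n _ n _ n])
    also have "b * (b' * a') = (b * b') * a'" using that(1-4) by (simp add: assoc_mult_mat [of _ n n _ n _ n])
    finally show ?thesis using that by simp
  qed
  have "(g * h) * (h' * g') = 1\<^sub>m n" "(h' * g') * (g * h) = 1\<^sub>m n"
    using * gh by (simp_all add: cancel)
  then show ?thesis
    unfolding GL_iff using * gh by (intro conjI bexI [of _ "h' * g'"]) simp_all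
qed

lemma Borel_mult:
  assumes "a \<in> Borel n" "b \<in> Borel n" shows "a * b \<in> Borel n"
proof -
  have dims: "a \<in> carrier_mat n n" "b \<in> carrier_mat n n" using assms by (auto simp: Borel_def GL_carrier)
  have "(a * b) $$ (i, j) = 0" if "j < i" "i < n" for i j
  proof -
    have "a $$ (i, k) * b $$ (k, j) = 0" if "k < n" for k
      using assms dims \<open>j < i\<close> \<open>i < n\<close> that unfolding Borel_def
      by (cases "k < i") (auto simp: upper_triangular_def)
    moreover have "(a * b) $$ (i, j) = (\<Sum>k = 0..<n. a $$ (i, k) * b $$ (k, j))"
      using dims that by (simp add: scalar_prod_def)
    ultimately show ?thesis by (simp only:) (rule sum.neutral, simp)
  qed
  then show ?thesis
    using assms dims by (auto simp: Borel_def GL_mult)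
qed

lemma mat_diag_Borel:
  assumes "\<And>i. i < n \<Longrightarrow> d i \<noteq> 0" shows "mat_diag n d \<in> Borel n"
proof -
  have "mat_diag n (\<lambda>i. d i * inverse (d i)) = 1\<^sub>m n" "mat_diag n (\<lambda>i. inverse (d i) * d i) = 1\<^sub>m n"
    using assms by (auto intro!: eq_matI simp: mat_diag_def)
  then have "mat_diag n d \<in> GL n"
    unfolding GL_iff by (intro conjI bexI [of _ "mat_diag n (\<lambda>i. inverse (d i))"]) simp_all
  then show ?thesis
    by (auto simp: Borel_def mat_diag_def upper_triangular_def)
qed

lemma one_Borel: "1\<^sub>m n \<in> Borel n"
  using mat_diag_Borel [of n "\<lambda>i. 1"] by simp

lemma topspace_flag_variety: "topspace (flag_variety n) = mat_coset n ` GL n"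
proof -
  have "topspace (GL_topology n) = GL n"
    unfolding GL_topology_def topspace_pullback_topology by auto
  then show ?thesis
    unfolding flag_variety_def
    using quotient_imp_surjective_map [OF quotient_map_quotient_topology [of "GL_topology n" "mat_coset n"]] by simp
qed

lemma acts_on_flag_variety: "acts_on (torus n) left_act (topspace (flag_variety n))"
  unfolding acts_on_def
proof (intro ballI)
  fix h k C assume h: "h \<in> torus n" and k: "k \<in> torus n" and C: "C \<in> topspace (flag_variety n)"
  have "C \<subseteq> carrier_mat n n"
    using C by (auto simp: topspace_flag_variety mat_coset_def Borel_def dest!: GL_carrier)
  then show "left_act (h * k) C = left_act h (left_act k C)"
    unfolding left_act_def image_image using torusD [OF h] torusD [OF k]
    by (intro image_cong refl) (auto simp: assoc_mult_mat [of _ n n _ n _ n])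
qed

lemma acts_on_subset: "acts_on K act S \<Longrightarrow> L \<subseteq> K \<Longrightarrow> T \<subseteq> S \<Longrightarrow> acts_on L act T"
  unfolding acts_on_def by blast

section \<open>Permutation matrices and the flags that they define\<close>

lemma perm_mat_carrier: "perm_mat n w \<in> carrier_mat n n"
  by (simp add: perm_mat_def)

lemma perm_index:
  assumes "w permutes {1..n}" "i < n"
  shows "w (Suc i) - 1 < n" "Suc (w (Suc i) - 1) = w (Suc i)"
proof -
  have "w (Suc i) \<in> {1..n}" using permutes_in_image [OF assms(1)] assms(2) by simp
  then show "w (Suc i) - 1 < n" "Suc (w (Suc i) - 1) = w (Suc i)" by auto
qed

text \<open>Row \<open>i\<close> has its single 1 in column \<open>inv' w (Suc i) - 1\<close>; the
  shifts arise because matrices count from 0 and permutations act on \<open>{1..n}\<close>.\<close>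

lemma perm_mat_sum:
  assumes w: "w permutes {1..n}" and i: "i < n"
  shows "(\<Sum>j<n. (if Suc i = w (Suc j) then 1 else 0) * f j) = (f (inv' w (Suc i) - 1) :: complex)"
proof -
  have inv: "inv' w permutes {1..n}" using w by (rule permutes_inv)
  have "Suc i = w (Suc j) \<longleftrightarrow> j = inv' w (Suc i) - 1" if "j < n" for j
    using perm_index [OF inv i] permutes_inverses [OF w] by (metis diff_Suc_1)
  then have "(\<Sum>j<n. (if Suc i = w (Suc j) then 1 else 0) * f j) =
      (\<Sum>j<n. if j = inv' w (Suc i) - 1 then f j else 0)"
    by (intro sum.cong) auto
  then show ?thesis using perm_index [OF inv i] by simp
qed

lemma perm_mat_GL:
  assumes w: "w permutes {1..n}" shows "perm_mat n w \<in> GL n"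
proof -
  have "perm_mat n u * perm_mat n (inv' u) = 1\<^sub>m n" if u: "u permutes {1..n}" for u
  proof (rule eq_matI)
    fix i j assume "i < dim_row (1\<^sub>m n :: complex mat)" "j < dim_col (1\<^sub>m n :: complex mat)"
    then have ij: "i < n" "j < n" by auto
    have "Suc (inv' u (Suc i) - 1) = inv' u (Suc j) \<longleftrightarrow> i = j"
      using perm_index [OF permutes_inv [OF u] ij(1)] permutes_inverses [OF u] by (metis nat.inject)
    then show "(perm_mat n u * perm_mat n (inv' u)) $$ (i, j) = 1\<^sub>m n $$ (i, j)"
      using ij perm_mat_sum [OF u ij(1), of "\<lambda>k. if Suc k = inv' u (Suc j) then 1 else 0"]
      by (simp add: perm_mat_def scalar_prod_def atLeast0LessThan)
  qed (simp_all add: perm_mat_def)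
  from this [OF w] this [OF permutes_inv [OF w]]
  show ?thesis
    unfolding GL_iff using perm_mat_carrier w
    by (intro conjI bexI [of _ "perm_mat n (inv' w)"]) (simp_all add: permutes_inv_inv)
qed

lemma perm_mat_mult_vec:
  assumes "w permutes {1..n}" "i < n" "c \<in> carrier_vec n"
  shows "(perm_mat n w *\<^sub>v c) $ i = c $ (inv' w (Suc i) - 1)"
  using perm_mat_sum [OF assms(1,2), of "\<lambda>j. c $ j"] assms
  by (simp add: perm_mat_def scalar_prod_def atLeast0LessThan)

lemma fixed_point_in_flag_variety:
  "w permutes {1..n} \<Longrightarrow> fixed_point n w \<in> topspace (flag_variety n)"
  by (simp add: topspace_flag_variety perm_mat_GL)

text \<open>Moving a diagonal matrix to the right of a permutation matrix only permutes its entries,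
  giving \<open>c\<close>, and the resulting diagonal matrix is absorbed by the Borel
  subgroup.\<close>

lemma left_act_fixed_point:
  assumes k: "k \<in> torus n" and w: "w permutes {1..n}"
  shows "left_act k (fixed_point n w) = fixed_point n w"
proof -
  obtain d where d: "k = mat_diag n d" "\<forall>i<n. cmod (d i) = 1"
    using k unfolding torus_def by blast
  define c where "c i = d (w (Suc i) - 1)" for i
  have c: "c i \<noteq> 0" if "i < n" for i
    using d(2) perm_index [OF w that] by (fastforce simp: c_def)
  have dc: "d i = c j" if "Suc i = w (Suc j)" for i j
    unfolding c_def that [symmetric] by simp
  have kP: "k * perm_mat n w = perm_mat n w * mat_diag n c"
    unfolding d(1) mat_diag_mult_left [OF perm_mat_carrier] mat_diag_mult_right [OF perm_mat_carrier]
    by (intro eq_matI) (auto simp: perm_mat_def dc)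
  have "mat_diag n c \<in> Borel n" by (rule mat_diag_Borel [OF c])
  have inv: "mat_diag n (\<lambda>i. inverse (c i)) \<in> Borel n" using c by (intro mat_diag_Borel) auto
  have carr: "b \<in> carrier_mat n n" if "b \<in> Borel n" for b
    using that by (simp add: Borel_def GL_carrier)
  have "(\<lambda>b. mat_diag n c * b) ` Borel n = Borel n"
  proof (intro equalityI subsetI)
    fix b assume b: "b \<in> Borel n"
    have "mat_diag n (\<lambda>i. c i * inverse (c i)) = 1\<^sub>m n"
      using c by (intro eq_matI) (auto simp: mat_diag_def)
    then have "b = mat_diag n c * (mat_diag n (\<lambda>i. inverse (c i)) * b)"
      using carr [OF b] by (simp add: assoc_mult_mat [of _ n n _ n _ n, symmetric])
    then show "b \<in> (\<lambda>b. mat_diag n c * b) ` Borel n"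
      using Borel_mult [OF inv b] by blast
  qed (auto intro: Borel_mult \<open>mat_diag n c \<in> Borel n\<close>)
  moreover have "left_act k (fixed_point n w) = (\<lambda>b. perm_mat n w * b) ` ((\<lambda>b. mat_diag n c * b) ` Borel n)"
    unfolding left_act_def mat_coset_def image_image
  proof (rule image_cong)
    fix b assume "b \<in> Borel n"
    then have bn: "b \<in> carrier_mat n n" by (rule carr)
    have kn: "k \<in> carrier_mat n n" using torusD [OF k] by simp
    have "k * (perm_mat n w * b) = (k * perm_mat n w) * b"
      by (rule assoc_mult_mat [OF kn perm_mat_carrier bn, symmetric])
    also have "\<dots> = perm_mat n w * (mat_diag n c * b)"
      unfolding kP by (rule assoc_mult_mat [OF perm_mat_carrier mat_diag_dim bn])
    finally show "k * (perm_mat n w * b) = perm_mat n w * (mat_diag n c * b)" .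
  qed simp
  ultimately show ?thesis by (simp add: mat_coset_def)
qed

lemma nilpotent_X_mult_vec:
  assumes "v \<in> carrier_vec n" "i < n"
  shows "(nilpotent_X n *\<^sub>v v) $ i = (if Suc i < n then v $ Suc i else 0)"
proof -
  have "(nilpotent_X n *\<^sub>v v) $ i = (\<Sum>j<n. (if j = Suc i then 1 else 0) * v $ j)"
    using assms by (simp add: nilpotent_X_def scalar_prod_def atLeast0LessThan)
  also have "\<dots> = (\<Sum>j<n. if j = Suc i then v $ j else 0)"
    by (rule sum.cong) auto
  finally show ?thesis by simp
qed

lemma fixed_point_in_peterson:
  assumes A: "A \<subseteq> {1..n - 1}"
  shows "fixed_point n (w_long n A) \<in> topspace (peterson_variety n)"
proof -
  let ?w = "w_long n A" and ?P = "perm_mat n (w_long n A)"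
  have w: "?w permutes {1..n}" using w_long_props(1) [OF A] by (rule parabolic_permutes)
  have wi: "inv' ?w permutes {1..n}" using w by (rule permutes_inv)
  have "nilpotent_X n *\<^sub>v v \<in> flag_space n (fixed_point n ?w) (i + 1)"
    if v: "v \<in> flag_space n (fixed_point n ?w) i" for v i
  proof -
    obtain b c where b: "b \<in> Borel n" and c: "c \<in> carrier_vec n" "\<forall>j\<in>{i..<n}. c $ j = 0"
      and vbc: "v = (?P * b) *\<^sub>v c"
      using v by (auto simp: flag_space_def mat_coset_def)
    have bn: "b \<in> carrier_mat n n" using b by (simp add: Borel_def GL_carrier)
    \<comment> \<open>An upper triangular \<open>b\<close> preserves the vectors supported on the
      first \<open>i\<close> coordinates, so the general representative reduces to the permutation
      matrix itself.\<close>
    define c' where "c' = b *\<^sub>v c"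
    have c': "c' \<in> carrier_vec n" using bn c by (simp add: c'_def)
    have c'0: "c' $ j = 0" if "i \<le> j" "j < n" for j
    proof -
      have "b $$ (j, k) * c $ k = 0" if "k < n" for k
        using b bn c(2) that \<open>i \<le> j\<close> \<open>j < n\<close> by (cases "k < j") (auto simp: Borel_def upper_triangular_def)
      moreover have "c' $ j = (\<Sum>k = 0..<n. b $$ (j, k) * c $ k)"
        using bn c(1) that by (simp add: c'_def scalar_prod_def)
      ultimately show ?thesis by (simp only:) (rule sum.neutral, simp)
    qed
    have vP: "v = ?P *\<^sub>v c'"
      unfolding vbc c'_def using bn c(1) perm_mat_carrier by (intro assoc_mult_mat_vec)
    \<comment> \<open>The coordinates of the image in the permuted basis, that is, the nilpotent
      matrix conjugated by the permutation matrix and applied to \<open>c'\<close>.\<close>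
    define c'' where "c'' = vec n (\<lambda>j. if ?w (Suc j) < n then c' $ (inv' ?w (Suc (?w (Suc j))) - 1) else 0)"
    have c'': "c'' \<in> carrier_vec n" by (simp add: c''_def)
    have "c'' $ j = 0" if "i + 1 \<le> j" "j < n" for j
    proof (cases "?w (Suc j) < n")
      case True
      define m where "m = inv' ?w (Suc (?w (Suc j)))"
      have wm: "?w m = Suc (?w (Suc j))" using permutes_inverses [OF w] by (simp add: m_def)
      have m: "m \<in> {1..n}" using permutes_in_image [OF wi] True by (simp add: m_def)
      have "?w (Suc j) \<noteq> 0" using perm_index(2) [OF w \<open>j < n\<close>] by auto
      then obtain k where "k \<le> Suc m" "?w k = ?w (Suc j)"
        using w_long_prev [OF A m] wm by auto
      then have "Suc j \<le> Suc m" using permutes_neq [OF w, of k "Suc j"] by auto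
      then have "i \<le> m - 1" "m - 1 < n" using that m by auto
      then show ?thesis using c'0 that True by (simp add: c''_def m_def)
    qed (use that in \<open>simp add: c''_def\<close>)
    moreover have "nilpotent_X n *\<^sub>v v = ?P *\<^sub>v c''"
    proof (rule eq_vecI)
      fix r assume "r < dim_vec (?P *\<^sub>v c'')"
      then have r: "r < n" by (simp add: perm_mat_def)
      have vn: "v \<in> carrier_vec n" unfolding vP using perm_mat_carrier c' by (rule mult_mat_vec_carrier)
      have ir: "inv' ?w (Suc r) - 1 < n" "Suc (inv' ?w (Suc r) - 1) = inv' ?w (Suc r)"
        using perm_index [OF wi r] by auto
      have "(?P *\<^sub>v c'') $ r = (if Suc r < n then c' $ (inv' ?w (Suc (Suc r)) - 1) else 0)"
        unfolding perm_mat_mult_vec [OF w r c'']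
        using ir permutes_inverses [OF w] by (simp add: c''_def)
      moreover have "v $ Suc r = c' $ (inv' ?w (Suc (Suc r)) - 1)" if "Suc r < n"
        unfolding vP by (rule perm_mat_mult_vec [OF w that c'])
      ultimately show "(nilpotent_X n *\<^sub>v v) $ r = (?P *\<^sub>v c'') $ r"
        by (simp add: nilpotent_X_mult_vec [OF vn r])
    qed (simp add: nilpotent_X_def perm_mat_def)
    moreover have "?P \<in> fixed_point n ?w"
      unfolding mat_coset_def using one_Borel perm_mat_carrier [of n ?w] by (intro image_eqI [of _ _ "1\<^sub>m n"]) auto
    ultimately show ?thesis
      unfolding flag_space_def using c'' by (intro CollectI exI [of _ ?P] exI [of _ c'']) auto
  qed
  then show ?thesis
    using fixed_point_in_flag_variety [OF w]
    by (auto simp: peterson_variety_def peterson_set_def)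
qed

section \<open>Localization of Peterson Schubert classes\<close>

text \<open>The map of classifying spaces induced by the inclusion of groups; both spaces are
  quotients of the same total space.\<close>

definition circle_to_torus :: "nat \<Rightarrow> (total \<times> unit) set \<Rightarrow> (total \<times> unit) set" where
  "circle_to_torus n = borel_map (torus n) (\<lambda>k x. x) (\<lambda>x. x)"

lemma circle_subset_torus: "circle n \<subseteq> torus n"
  and circle_nonempty: "circle n \<noteq> {}" and torus_nonempty: "torus n \<noteq> {}"
  using diagonal_group_circle [of n] by (auto simp: diagonal_group_def)

lemma continuous_circle_to_torus:
  "continuous_map (B_pt n (circle n)) (B_pt n (torus n)) (circle_to_torus n)"
  unfolding circle_to_torus_def
  by (rule continuous_borel_map [OF diagonal_group_torus acts_on_trivial circle_subset_torus circle_nonempty])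
     simp_all

lemma circle_to_torus_orbit:
  "circle_to_torus n (borel_orbit (circle n) (\<lambda>k x. x) (e, ())) = borel_orbit (torus n) (\<lambda>k x. x) (e, ())"
  unfolding circle_to_torus_def
  by (rule borel_map_orbit [OF diagonal_group_torus acts_on_trivial [of _ UNIV] circle_subset_torus circle_nonempty]) auto

text \<open>A commuting square: from the classifying space of the circle, both routes send the orbit
  of \<open>e\<close> to the torus orbit of \<open>e\<close> paired with the fixed flag. Billey's
  formula, given only for the torus, thereby becomes available for the circle.\<close>

lemma localize_peterson_class:
  assumes A: "A \<subseteq> {1..n - 1}"
    and S: "\<sigma> v \<in> carrier (cohomology (borel_space n (torus n) left_act (flag_variety n)))"
  shows "localize n (circle n) (peterson_class n \<sigma> v) (w_long n A) =
         pullback (B_pt n (circle n)) (circle_to_torus n) (localize n (torus n) (\<sigma> v) (w_long n A))"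
proof -
  let ?p = "fixed_point n (w_long n A)"
  let ?pt = "discrete_topology {()}"
  have w: "w_long n A permutes {1..n}" using w_long_props(1) [OF A] by (rule parabolic_permutes)
  have pP: "?p \<in> topspace (peterson_variety n)" by (rule fixed_point_in_peterson [OF A])
  have pF: "?p \<in> topspace (flag_variety n)" by (rule fixed_point_in_flag_variety [OF w])
  have sub: "topspace (peterson_variety n) \<subseteq> topspace (flag_variety n)"
    by (simp add: peterson_variety_def)
  note fix_t = left_act_fixed_point [OF _ w]
  have fix_c: "left_act k ?p = ?p" if "k \<in> circle n" for k
    using that circle_subset_torus fix_t by blast
  note act_t = acts_on_flag_variety [of n]
  have act_c: "acts_on (circle n) left_act (topspace (flag_variety n))"
    by (rule acts_on_subset [OF act_t circle_subset_torus order_refl])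
  have act_p: "acts_on (circle n) left_act (topspace (peterson_variety n))"
    by (rule acts_on_subset [OF act_c order_refl sub])
  let ?f0 = "borel_map (circle n) left_act (\<lambda>_::unit. ?p)"
  let ?f1 = "borel_map (circle n) left_act (\<lambda>C. C)"
  let ?f2 = "borel_map (torus n) left_act (\<lambda>C. C)"
  let ?g = "borel_map (torus n) left_act (\<lambda>_::unit. ?p)"
  let ?Bc = "B_pt n (circle n)"
  let ?Bp = "borel_space n (circle n) left_act (peterson_variety n)"
  let ?Bf = "borel_space n (circle n) left_act (flag_variety n)"
  let ?Bt = "borel_space n (torus n) left_act (flag_variety n)"
  have c0: "continuous_map ?Bc ?Bp ?f0"
    by (rule continuous_borel_map [OF diagonal_group_circle act_p order_refl circle_nonempty])
       (use pP fix_c in \<open>auto simp: continuous_map_const\<close>)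
  have c1: "continuous_map ?Bp ?Bf ?f1"
    by (rule continuous_borel_map [OF diagonal_group_circle act_c order_refl circle_nonempty])
       (auto simp: peterson_variety_def)
  have c2: "continuous_map ?Bf ?Bt ?f2"
    by (rule continuous_borel_map [OF diagonal_group_torus act_t circle_subset_torus circle_nonempty]) auto
  have cg: "continuous_map (B_pt n (torus n)) ?Bt ?g"
    by (rule continuous_borel_map [OF diagonal_group_torus act_t order_refl torus_nonempty])
       (use pF fix_t in \<open>auto simp: continuous_map_const\<close>)
  have "localize n (circle n) (peterson_class n \<sigma> v) (w_long n A) =
      pullback ?Bc ?f0 (pullback ?Bp (?f2 \<circ> ?f1) (\<sigma> v))"
    unfolding localize_def peterson_class_def restrict_to_peterson_def restrict_to_circle_def
    by (simp only: pullback_compose [OF c1 c2 S])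
  also have "\<dots> = pullback ?Bc ((?f2 \<circ> ?f1) \<circ> ?f0) (\<sigma> v)"
    by (rule pullback_compose [OF c0 continuous_map_compose [OF c1 c2] S])
  also have "\<dots> = pullback ?Bc (?g \<circ> circle_to_torus n) (\<sigma> v)"
  proof (rule pullback_cong)
    fix Q assume "Q \<in> topspace ?Bc"
    then obtain e where Q: "Q = borel_orbit (circle n) (\<lambda>k x. x) (e, ())"
      by (auto simp: topspace_borel_space)
    have "?f0 Q = borel_orbit (circle n) left_act (e, ?p)"
      unfolding Q by (rule borel_map_orbit [OF diagonal_group_circle act_p order_refl circle_nonempty])
        (use pP fix_c in auto)
    moreover have "?f1 \<dots> = borel_orbit (circle n) left_act (e, ?p)"
      by (rule borel_map_orbit [OF diagonal_group_circle act_c order_refl circle_nonempty]) (use pF in auto)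
    moreover have "?f2 \<dots> = borel_orbit (torus n) left_act (e, ?p)"
      by (rule borel_map_orbit [OF diagonal_group_torus act_t circle_subset_torus circle_nonempty]) (use pF in auto)
    moreover have "?g (circle_to_torus n Q) = borel_orbit (torus n) left_act (e, ?p)"
      unfolding Q circle_to_torus_orbit
      by (rule borel_map_orbit [OF diagonal_group_torus act_t order_refl torus_nonempty]) (use pF fix_t in auto)
    ultimately show "((?f2 \<circ> ?f1) \<circ> ?f0) Q = (?g \<circ> circle_to_torus n) Q" by simp
  qed
  also have "\<dots> = pullback ?Bc (circle_to_torus n) (pullback (B_pt n (torus n)) ?g (\<sigma> v))"
    by (rule pullback_compose [OF continuous_circle_to_torus cg S, symmetric])
  finally show ?thesis by (simp add: localize_def)
qed

section \<open>Null-homotopic loops\<close>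

definition const_simplex :: "nat \<Rightarrow> 'a \<Rightarrow> (nat \<Rightarrow> real) \<Rightarrow> 'a" where
  "const_simplex p x = restrict (\<lambda>_. x) (standard_simplex p)"

lemma singular_const_simplex: "x \<in> topspace X \<Longrightarrow> singular_simplex p X (const_simplex p x)"
  unfolding singular_simplex_def const_simplex_def by (auto intro: continuous_map_eq [OF continuous_map_const [THEN iffD2]])

text \<open>All three faces are the same constant simplex, with signs 1, -1, 1.\<close>

lemma coboundary_const_simplex:
  assumes "x \<in> topspace X"
  shows "coboundary X f 2 (const_simplex 2 x) = f 1 (const_simplex 1 x)"
proof -
  have "singular_face 2 k (const_simplex 2 x) = const_simplex 1 x" if "k \<le> 2" for k
    using simplical_face_in_standard_simplex [of 2 k] that
    by (auto simp: singular_face_def const_simplex_def fun_eq_iff restrict_def)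
  then show ?thesis
    using singular_const_simplex [OF assms, of 2]
    by (simp add: coboundary_def numeral_2_eq_2)
qed

lemma simplex_map_const: "simplex_map p F (const_simplex p x) = const_simplex p (F x)"
  by (auto simp: simplex_map_def const_simplex_def)

text \<open>The straight line from the torus point with coordinates \<open>exp (2 \<pi> i a\<^sub>i y)\<close>, placed in the first
  slot of every factor of the total space, to the basis vector of the second slot. Passing through
  two independent slots, it never meets \<open>0\<close>.\<close>

definition line_point :: "nat \<Rightarrow> (nat \<Rightarrow> int) \<Rightarrow> real \<Rightarrow> real \<Rightarrow> total" where
  "line_point n a y r = (\<lambda>i m. if i < n then
     if m = 0 then of_real (1 - r) * cis (2 * pi * of_int (a i) * y) else if m = 1 then of_real r else 0
     else 0)"

definition line_simplex ::
    "nat \<Rightarrow> (nat \<Rightarrow> int) \<Rightarrow> nat \<Rightarrow> ((nat \<Rightarrow> real) \<Rightarrow> real) \<Rightarrow> ((nat \<Rightarrow> real) \<Rightarrow> real) \<Rightarrow> (nat \<Rightarrow> real) \<Rightarrow> total" where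
  "line_simplex n a p y r = restrict (\<lambda>x. line_point n a (y x) (r x)) (standard_simplex p)"

lemma line_point_in: "line_point n a y r \<in> topspace (ET n)"
proof -
  have "line_point n a y r i \<noteq> (\<lambda>m. 0)" if "i < n" for i
  proof -
    have "line_point n a y r i (if r = 0 then 0 else 1) \<noteq> 0"
      using that by (simp add: line_point_def)
    then show ?thesis by metis
  qed
  then show ?thesis by (auto simp: ET_def line_point_def)
qed

lemma singular_line_simplex:
  assumes "continuous_on UNIV y" "continuous_on UNIV r"
  shows "singular_simplex p (ET n) (line_simplex n a p y r)"
proof -
  have "continuous_on UNIV (\<lambda>x. line_point n a (y x) (r x) i m)" for i m
    unfolding line_point_def using assms
    by (cases "i < n"; cases "m = 0"; cases "m = 1") (auto intro!: continuous_intros)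
  then have "continuous_on UNIV (\<lambda>x. line_point n a (y x) (r x))"
    by (intro continuous_on_coordinatewise_then_product)
  then have "continuous_on (standard_simplex p) (\<lambda>x. line_point n a (y x) (r x))"
    by (rule continuous_on_subset) simp
  then have "continuous_map (top_of_set (standard_simplex p)) (ET n) (\<lambda>x. line_point n a (y x) (r x))"
    using line_point_in unfolding ET_def by (auto simp: continuous_map_in_subtopology)
  then show ?thesis
    unfolding singular_simplex_def line_simplex_def euclidean_product_topology
    by (auto intro: continuous_map_eq)
qed

lemma coboundary_line_simplex:
  assumes "continuous_on UNIV y" "continuous_on UNIV r"
  shows "coboundary (ET n) f 2 (line_simplex n a 2 y r) =
     f 1 (line_simplex n a 1 (\<lambda>x. y (simplical_face 0 x)) (\<lambda>x. r (simplical_face 0 x))) -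
     f 1 (line_simplex n a 1 (\<lambda>x. y (simplical_face 1 x)) (\<lambda>x. r (simplical_face 1 x))) +
     f 1 (line_simplex n a 1 (\<lambda>x. y (simplical_face 2 x)) (\<lambda>x. r (simplical_face 2 x)))"
proof -
  have "singular_face 2 k (line_simplex n a 2 y r) =
      line_simplex n a 1 (\<lambda>x. y (simplical_face k x)) (\<lambda>x. r (simplical_face k x))" if "k \<le> 2" for k
    using simplical_face_in_standard_simplex [of 2 k] that
    by (auto simp: singular_face_def line_simplex_def fun_eq_iff restrict_def)
  then show ?thesis
    using singular_line_simplex [OF assms, of 2 n a]
    by (simp add: coboundary_def numeral_2_eq_2)
qed

lemma line_simplex_cong:
  assumes "\<And>x. x \<in> standard_simplex p \<Longrightarrow> line_point n a (y x) (r x) = line_point n a (y' x) (r' x)"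
  shows "line_simplex n a p y r = line_simplex n a p y' r'"
  using assms by (auto simp: line_simplex_def fun_eq_iff restrict_def)

text \<open>The loop bounds the two triangles of the square swept out by the line; the sides of the square
  cancel and its far edge is constant.\<close>

lemma cocycle_on_orbit_loop:
  assumes z: "\<And>s. coboundary (ET n) z 2 s = 0"
  shows "z 1 (orbit_loop n a (line_point n (\<lambda>_. 0) 0 0)) = 0"
proof -
  let ?H = "line_simplex n a"
  let ?e = "line_point n a 0 1"
  have s1: "x 0 + x (Suc 0) = 1" if "x \<in> standard_simplex (Suc 0)" for x
    using that by (simp add: standard_simplex_def)
  have cont: "continuous_on UNIV (\<lambda>x::nat \<Rightarrow> real. x i)" for i
    by (rule continuous_on_product_coordinates)
  have cis_int: "cis (2 * pi * of_int k) = 1" for k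
    by (simp add: cis_multiple_2pi)
  \<comment> \<open>In the coordinates \<open>(y, r)\<close>, the triangle with vertices (0,0),
    (1,0), (1,1). Its side \<open>y = 1\<close> equals the side \<open>y = 0\<close> by periodicity
    of \<open>cis\<close>.\<close>
  have "z 1 (?H 1 (\<lambda>x. 0) (\<lambda>x. x 1)) - z 1 (?H 1 (\<lambda>x. x 1) (\<lambda>x. x 1)) + z 1 (?H 1 (\<lambda>x. x 1) (\<lambda>x. 0)) =
      coboundary (ET n) z 2 (?H 2 (\<lambda>x. x 1 + x 2) (\<lambda>x. x 2))"
  proof -
    have "?H 1 (\<lambda>x. x 0 + x 1) (\<lambda>x. x 1) = ?H 1 (\<lambda>x. 0) (\<lambda>x. x 1)"
      by (rule line_simplex_cong) (auto simp: s1 line_point_def fun_eq_iff cis_int)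
    then show ?thesis
      using cont by (subst coboundary_line_simplex) (auto intro!: continuous_intros simp: simplical_face_def)
  qed
  \<comment> \<open>The complementary triangle, with vertices (0,0), (0,1), (1,1); its edge
    \<open>r = 1\<close> is constant.\<close>
  moreover have "z 1 (const_simplex 1 ?e) - z 1 (?H 1 (\<lambda>x. x 1) (\<lambda>x. x 1)) + z 1 (?H 1 (\<lambda>x. 0) (\<lambda>x. x 1)) =
      coboundary (ET n) z 2 (?H 2 (\<lambda>x. x 2) (\<lambda>x. x 1 + x 2))"
  proof -
    have "?H 1 (\<lambda>x. x 1) (\<lambda>x. x 0 + x 1) = const_simplex 1 ?e"
      by (auto simp: line_simplex_def const_simplex_def s1 line_point_def fun_eq_iff restrict_def)
    then show ?thesis
      using cont by (subst coboundary_line_simplex) (auto intro!: continuous_intros simp: simplical_face_def)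
  qed
  moreover have "z 1 (const_simplex 1 ?e) = 0"
    using coboundary_const_simplex [OF line_point_in [of n a 0 1], of z] z by simp
  moreover have "orbit_loop n a (line_point n (\<lambda>_. 0) 0 0) = ?H 1 (\<lambda>x. x 1) (\<lambda>x. 0)"
    by (auto simp: orbit_loop_def line_simplex_def line_point_def ET_act_def cocharacter_def mat_diag_def
        fun_eq_iff restrict_def)
  ultimately show ?thesis by (simp add: z)
qed

section \<open>Chern classes on the classifying space of the circle\<close>

abbreviation pt_orbit :: "complex mat set \<Rightarrow> total \<Rightarrow> (total \<times> unit) set" where
  "pt_orbit K e \<equiv> borel_orbit K (\<lambda>k x. x) (e, ())"

lemma chern_class_carrier: "chern_class n K \<psi> C \<Longrightarrow> C \<in> carrier (H_pt n K)"
  by (simp add: chern_class_def)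

text \<open>The same transgression cochain \<open>b\<close> serves both groups, since they share the
  total space and every cocharacter of the circle is one of the torus.\<close>

lemma chern_class_circle_to_torus:
  assumes "chern_class n (torus n) \<psi> C"
  shows "chern_class n (circle n) \<psi> (pullback (B_pt n (circle n)) (circle_to_torus n) C)"
proof -
  let ?X = "B_pt n (circle n)" and ?\<pi> = "circle_to_torus n"
  obtain c b where C: "C \<in> carrier (H_pt n (torus n))" and c: "c \<in> C" "\<forall>p s. p \<noteq> 2 \<longrightarrow> c p s = 0"
    and b: "b \<in> cochains (ET n)" "coboundary (ET n) b = pullback_cochain (ET n) (pt_orbit (torus n)) c"
    and loops: "\<forall>e\<in>topspace (ET n). \<forall>a d. (\<forall>r. cocharacter n a r \<in> torus n \<and>
        \<psi> (cocharacter n a r) = cis (2 * pi * of_int d * r)) \<longrightarrow> b 1 (orbit_loop n a e) = of_int d"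
    using assms unfolding chern_class_def by blast
  note c_coset = carrier_cohomology_coset [OF C c(1)]
  have pC: "pullback ?X ?\<pi> C = coho_class ?X (pullback_cochain ?X ?\<pi> c)"
    unfolding c_coset(2) by (rule pullback_coho_class [OF continuous_circle_to_torus c_coset(1)])
  have "pullback ?X ?\<pi> C \<in> carrier (H_pt n (circle n))"
    by (rule ring_hom_closed [OF pullback_ring_hom [OF continuous_circle_to_torus] C])
  moreover have "pullback_cochain ?X ?\<pi> c \<in> pullback ?X ?\<pi> C"
    unfolding pC by (rule coho_class_self)
  moreover have "\<forall>p s. p \<noteq> 2 \<longrightarrow> pullback_cochain ?X ?\<pi> c p s = 0"
    using c(2) by (simp add: pullback_cochain_def)
  moreover have "coboundary (ET n) b =
      pullback_cochain (ET n) (pt_orbit (circle n)) (pullback_cochain ?X ?\<pi> c)"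
    unfolding pullback_cochain_compose [OF continuous_orbit_pt] b(2)
    unfolding o_def circle_to_torus_orbit by (rule refl)
  moreover have "\<forall>e\<in>topspace (ET n). \<forall>a d. (\<forall>r. cocharacter n a r \<in> circle n \<and>
        \<psi> (cocharacter n a r) = cis (2 * pi * of_int d * r)) \<longrightarrow> b 1 (orbit_loop n a e) = of_int d"
    using loops circle_subset_torus by blast
  ultimately show ?thesis unfolding chern_class_def using b(1) by blast
qed

text \<open>The loop running once around the circle. Its \<open>k\<close>-th diagonal entry, counted
  from 1, winds \<open>n + 1 - k\<close> times, which is the origin of these constants.\<close>

lemma cocharacter_circle: "cocharacter n (\<lambda>i. int (n - i)) r \<in> circle n"
  unfolding circle_def cocharacter_def
  by (rule CollectI, rule exI [of _ "cis (2 * pi * r)"])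
     (simp add: Complex.DeMoivre mult_ac)

text \<open>In degree 2, \<open>b1 - p * b2\<close> and the pullback of \<open>h\<close> have the
  same coboundary, so they agree on a loop that bounds. On a loop in one orbit, \<open>b1\<close>
  and \<open>b2\<close> give winding numbers, whereas the pullback of \<open>h\<close> sees only a
  constant simplex.\<close>

lemma chern_class_circle_unique:
  assumes k1: "k1 \<in> {1..n}" and k2: "k2 \<in> {1..n}"
    and c1: "\<forall>p s. p \<noteq> 2 \<longrightarrow> c1 p s = 0" and c2: "\<forall>p s. p \<noteq> 2 \<longrightarrow> c2 p s = 0"
    and b1: "coboundary (ET n) b1 = pullback_cochain (ET n) (pt_orbit (circle n)) c1"
      "\<forall>e\<in>topspace (ET n). \<forall>a d. (\<forall>r. cocharacter n a r \<in> circle n \<and>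
        cocharacter n a r $$ (k1 - 1, k1 - 1) = cis (2 * pi * of_int d * r)) \<longrightarrow> b1 1 (orbit_loop n a e) = of_int d"
    and b2: "coboundary (ET n) b2 = pullback_cochain (ET n) (pt_orbit (circle n)) c2"
      "\<forall>e\<in>topspace (ET n). \<forall>a d. (\<forall>r. cocharacter n a r \<in> circle n \<and>
        cocharacter n a r $$ (k2 - 1, k2 - 1) = cis (2 * pi * of_int d * r)) \<longrightarrow> b2 1 (orbit_loop n a e) = of_int d"
    and h: "\<And>s. c1 2 s = coboundary (B_pt n (circle n)) h 2 s + p * c2 2 s"
  shows "of_nat (n + 1 - k1) = p * of_nat (n + 1 - k2)"
proof -
  let ?X = "B_pt n (circle n)" and ?q = "pt_orbit (circle n)"
  let ?a = "\<lambda>i. int (n - i)" and ?e = "line_point n (\<lambda>_. 0) 0 0"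
  have e: "?e \<in> topspace (ET n)" by (rule line_point_in)
  have q: "?q ?e \<in> topspace ?X"
    using continuous_map_image_subset_topspace [OF continuous_orbit_pt] e by (metis image_subset_iff)
  have diag: "cocharacter n a r $$ (k - Suc 0, k - Suc 0) = cis (2 * pi * of_int (a (k - Suc 0)) * r)"
    if "k \<in> {1..n}" for a r k
    using that by (auto simp: cocharacter_def mat_diag_def)
  have "cocharacter n (\<lambda>_. 0) r = 1\<^sub>m n" for r by (simp add: cocharacter_def)
  then have zero: "cocharacter n (\<lambda>_. 0) r \<in> circle n" for r
    using diagonal_group_circle by (simp add: diagonal_group_def)
  \<comment> \<open>The trivial cocharacter, of degree 0, shows that \<open>b1\<close> and
    \<open>b2\<close> vanish on a constant 1-simplex. This forces \<open>c1\<close>,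
    \<open>c2\<close> and then \<open>h\<close> to vanish on constant simplices, although no cochain
    is assumed normalized.\<close>
  have loop0: "orbit_loop n (\<lambda>_. 0) ?e = const_simplex 1 ?e"
    by (auto simp: orbit_loop_def const_simplex_def cocharacter_def ET_act_def line_point_def
        fun_eq_iff restrict_def)
  have const0: "c 2 (const_simplex 2 (?q ?e)) = 0"
    if "coboundary (ET n) b = pullback_cochain (ET n) ?q c" "b 1 (const_simplex 1 ?e) = 0" for b c
    using coboundary_const_simplex [OF e, of b] that singular_const_simplex [OF e, of 2]
    by (simp add: pullback_cochain_def simplex_map_const)
  have "b1 1 (const_simplex 1 ?e) = 0" "b2 1 (const_simplex 1 ?e) = 0"
    using b1(2) [rule_format, OF e, of "\<lambda>_. 0" 0] b2(2) [rule_format, OF e, of "\<lambda>_. 0" 0] k1 k2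
    by (simp_all add: zero diag loop0)
  then have c0: "c1 2 (const_simplex 2 (?q ?e)) = 0" "c2 2 (const_simplex 2 (?q ?e)) = 0"
    using const0 [OF b1(1)] const0 [OF b2(1)] by auto
  then have h0: "h 1 (const_simplex 1 (?q ?e)) = 0"
    using h [of "const_simplex 2 (?q ?e)"] coboundary_const_simplex [OF q, of h] by simp
  define z where "z = (\<lambda>m s. b1 m s - (p * b2 m s + pullback_cochain (ET n) ?q h m s))"
  have "coboundary (ET n) z 2 s = 0" for s
    unfolding z_def coboundary_diff coboundary_add coboundary_scale b1 b2
      coboundary_pullback [OF continuous_orbit_pt]
    by (simp add: pullback_cochain_def h)
  then have "z 1 (orbit_loop n ?a ?e) = 0"
    by (rule cocycle_on_orbit_loop)
  moreover have "b1 1 (orbit_loop n ?a ?e) = of_nat (n + 1 - k1)" "b2 1 (orbit_loop n ?a ?e) = of_nat (n + 1 - k2)"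
    using b1(2) [rule_format, OF e, of ?a "int (n + 1 - k1)"] b2(2) [rule_format, OF e, of ?a "int (n + 1 - k2)"] k1 k2
    by (auto simp: cocharacter_circle diag)
  moreover have "pullback_cochain (ET n) ?q h 1 (orbit_loop n ?a ?e) = 0"
  proof -
    have "?q (ET_act (cocharacter n ?a r) ?e) = ?q ?e" for r
      using borel_orbit_act [OF diagonal_group_circle acts_on_trivial [of _ UNIV] cocharacter_circle [of n r], of "()" ?e]
      by simp
    then have eq: "simplex_map 1 ?q (orbit_loop n ?a ?e) = const_simplex 1 (?q ?e)"
      by (auto simp: simplex_map_def orbit_loop_def const_simplex_def fun_eq_iff restrict_def)
    show ?thesis unfolding pullback_cochain_def eq h0 by (rule if_cancel)
  qed
  ultimately show ?thesis by (simp add: z_def)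
qed

section \<open>Degree-two classes as linear polynomials\<close>

lemma poly_ring_simps:
  "carrier poly_ring = UNIV" "monoid.mult poly_ring = (*)" "one poly_ring = 1" "zero poly_ring = 0"
  "add poly_ring = (+)"
  by (simp_all add: poly_ring_def)

text \<open>The clause on degree \<open>0\<close> carries the induction on the polynomial.\<close>

lemma circle_identification_cocycle:
  assumes \<iota>: "circle_identification n \<iota>"
    and c: "c \<in> \<iota> [:0, 1:]" "\<forall>p s. p \<noteq> 2 \<longrightarrow> c p s = 0"
  shows "\<exists>f\<in>\<iota> P. (\<forall>s. f 0 s = const_cochain (B_pt n (circle n)) (coeff P 0) 0 s) \<and>
           (\<forall>s. f 2 s = coeff P 1 * c 2 s)"
proof (induction P)
  case 0
  have "\<iota> 0 = coho_class (B_pt n (circle n)) (const_cochain (B_pt n (circle n)) 0)"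
    using \<iota> unfolding circle_identification_def by (metis const_class_eq pCons_0_0)
  then show ?case
    using coho_class_self by (intro bexI [of _ "const_cochain (B_pt n (circle n)) 0"]) (auto simp: const_cochain_def)
next
  case (pCons a P)
  let ?X = "B_pt n (circle n)"
  have hom: "\<iota> \<in> Ring.ring_hom poly_ring (cohomology ?X)"
    using \<iota> by (simp add: circle_identification_def ring_iso_def)
  have carr: "\<iota> Q \<in> carrier (cohomology ?X)" for Q
    using ring_hom_closed [OF hom] by (simp add: poly_ring_simps)
  obtain f where f: "f \<in> \<iota> P" "\<forall>s. f 0 s = const_cochain ?X (coeff P 0) 0 s" "\<forall>s. f 2 s = coeff P 1 * c 2 s"
    using pCons by blast
  note cc = carrier_cohomology_coset [OF carr c(1)] and ff = carrier_cohomology_coset [OF carr f(1)]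
  let ?g = "\<lambda>p s. const_cochain ?X a p s + cup ?X c f p s"
  have "\<iota> (pCons a P) = \<iota> [:a:] \<oplus>\<^bsub>cohomology ?X\<^esub> (\<iota> [:0, 1:] \<otimes>\<^bsub>cohomology ?X\<^esub> \<iota> P)"
    using ring_hom_add [OF hom, of "[:a:]" "[:0, 1:] * P"] ring_hom_mult [OF hom, of "[:0, 1:]" P]
    by (simp add: poly_ring_simps)
  also have "\<dots> = coho_class ?X ?g"
    unfolding cc(2) ff(2) using \<iota> cc(1) ff(1)
    by (simp add: circle_identification_def const_class_eq coho_class_mult coho_class_add cocycle_const cocycle_cup)
  finally have eq: "\<iota> (pCons a P) = coho_class ?X ?g" .
  have "cup ?X c f 0 s = 0" for s
    using c(2) by (simp add: cup_def)
  moreover have "cup ?X c f 2 s = coeff P 0 * c 2 s" for s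
  proof -
    \<comment> \<open>Since \<open>c\<close> lives in degree 2 alone, the product in degree 2 meets
      only the degree 0 part of \<open>f\<close>, known by induction.\<close>
    have "c i u * f (2 - i) v = c i u * const_cochain ?X (coeff P 0) (2 - i) v" if "i \<le> 2" for i u v
      using c(2) f(2) by (cases "i = 2") auto
    then have "cup ?X c f 2 s = cup ?X c (const_cochain ?X (coeff P 0)) 2 s"
      unfolding cup_def by (intro if_cong sum.cong refl) auto
    also have "\<dots> = coeff P 0 * c 2 s"
      using cup_const_right [of c ?X "coeff P 0"] cc(1) by (simp add: cocycle_iff)
    finally show ?thesis .
  qed
  ultimately show ?case
    unfolding eq by (intro bexI [OF _ coho_class_self]) (simp add: const_cochain_def coeff_pCons)
qed

text \<open>As \<open>\<iota>\<close> is onto, \<open>C\<close> is \<open>\<iota> P\<close> for some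
  \<open>P\<close>, and the orbit loop determines \<open>coeff P 1\<close>. The other coefficients
  drop out because \<open>C\<close> has a representative concentrated in degree 2.\<close>

lemma circle_identification_chern_class:
  assumes \<iota>: "circle_identification n \<iota>" and k: "k \<in> {1..n}"
    and C: "chern_class n (circle n) (\<lambda>d. d $$ (k - 1, k - 1)) C"
  shows "C = \<iota> [:0, of_nat (n + 1 - k):]"
proof -
  let ?X = "B_pt n (circle n)"
  have hom: "\<iota> \<in> Ring.ring_hom poly_ring (cohomology ?X)" and bij: "bij_betw \<iota> UNIV (carrier (cohomology ?X))"
    using \<iota> by (simp_all add: circle_identification_def ring_iso_def poly_ring_simps)
  have carr: "\<iota> Q \<in> carrier (cohomology ?X)" for Q
    using ring_hom_closed [OF hom] by (simp add: poly_ring_simps)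
  have n: "n \<in> {1..n}" using k by auto
  have "chern_class n (circle n) (\<lambda>d. d $$ (n - 1, n - 1)) (\<iota> [:0, 1:])"
    using \<iota> by (simp add: circle_identification_def)
  then obtain c2 b2 where c2: "c2 \<in> \<iota> [:0, 1:]" "\<forall>p s. p \<noteq> 2 \<longrightarrow> c2 p s = 0"
    and b2: "coboundary (ET n) b2 = pullback_cochain (ET n) (pt_orbit (circle n)) c2"
      "\<forall>e\<in>topspace (ET n). \<forall>a d. (\<forall>r. cocharacter n a r \<in> circle n \<and>
        cocharacter n a r $$ (n - 1, n - 1) = cis (2 * pi * of_int d * r)) \<longrightarrow> b2 1 (orbit_loop n a e) = of_int d"
    unfolding chern_class_def by blast
  obtain c1 b1 where C1: "C \<in> carrier (cohomology ?X)" and c1: "c1 \<in> C" "\<forall>p s. p \<noteq> 2 \<longrightarrow> c1 p s = 0"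
    and b1: "coboundary (ET n) b1 = pullback_cochain (ET n) (pt_orbit (circle n)) c1"
      "\<forall>e\<in>topspace (ET n). \<forall>a d. (\<forall>r. cocharacter n a r \<in> circle n \<and>
        cocharacter n a r $$ (k - 1, k - 1) = cis (2 * pi * of_int d * r)) \<longrightarrow> b1 1 (orbit_loop n a e) = of_int d"
    using C unfolding chern_class_def by blast
  obtain P where P: "C = \<iota> P" using C1 bij by (metis bij_betw_imp_surj_on imageE)
  obtain f where f: "f \<in> \<iota> P" "\<forall>s. f 2 s = coeff P 1 * c2 2 s"
    using circle_identification_cocycle [OF \<iota> c2, of P] by blast
  have "C = coho_class ?X f" using carrier_cohomology_coset [OF carr f(1)] P by simp
  then obtain h where h: "h \<in> cochains ?X" "c1 = (\<lambda>p s. coboundary ?X h p s + f p s)"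
    using c1(1) by (auto simp: in_coho_class_iff)
  define p where "p = coeff P 1"
  have h2: "c1 2 s = coboundary ?X h 2 s + p * c2 2 s" for s
    using f(2) by (simp add: h(2) p_def)
  have p: "of_nat (n + 1 - k) = p"
    using chern_class_circle_unique [OF k n c1(2) c2(2) b1 b2 h2] by simp
  \<comment> \<open>Only the degree 1 part of \<open>h\<close> is kept, so that its coboundary lies
    in degree 2 and the relation between \<open>c1\<close> and \<open>c2\<close> holds in all
    degrees.\<close>
  let ?h = "\<lambda>m s. (if m = 1 then 1 else 0) * h m s"
  have "?h \<in> cochains ?X" by (rule cochains_scale [OF h(1)])
  moreover have "c1 = (\<lambda>m s. coboundary ?X ?h m s + p * c2 m s)"
  proof (intro ext)
    fix m s
    have "coboundary ?X h 0 s = 0" by (rule coboundary_0)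
    then show "c1 m s = coboundary ?X ?h m s + p * c2 m s"
      unfolding coboundary_scale using h2 [of s] c1(2) c2(2)
      by (cases "m = 2") (auto simp: coboundary_0 not_less_eq_eq)
  qed
  ultimately have "c1 \<in> coho_class ?X (\<lambda>m s. p * c2 m s)"
    unfolding in_coho_class_iff by blast
  then have "C = coho_class ?X (\<lambda>m s. p * c2 m s)"
    using carrier_cohomology_coset(2) [OF C1 c1(1)] coho_class_eqI by metis
  also have "\<dots> = coho_class ?X (const_cochain ?X p) \<otimes>\<^bsub>cohomology ?X\<^esub> coho_class ?X c2"
    using carrier_cohomology_coset(1) [OF carr c2(1)]
    by (simp add: coho_class_mult cocycle_const cup_const_left cocycle_iff)
  also have "\<dots> = \<iota> [:p:] \<otimes>\<^bsub>cohomology ?X\<^esub> \<iota> [:0, 1:]"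
    using \<iota> carrier_cohomology_coset(2) [OF carr c2(1)]
    by (simp add: circle_identification_def const_class_eq)
  also have "\<dots> = \<iota> [:0, p:]"
    using ring_hom_mult [OF hom, of "[:p:]" "[:0, 1:]"] by (simp add: poly_ring_simps)
  finally show ?thesis using p by simp
qed

section \<open>Values of Peterson Schubert classes\<close>

lemma ring_poly_ring: "ring poly_ring"
proof (rule ringI)
  show "abelian_group poly_ring"
  proof (rule abelian_groupI)
    fix p assume "p \<in> carrier poly_ring"
    show "\<exists>q\<in>carrier poly_ring. q \<oplus>\<^bsub>poly_ring\<^esub> p = \<zero>\<^bsub>poly_ring\<^esub>"
      by (rule bexI [of _ "- p"]) (simp_all add: poly_ring_simps)
  qed (simp_all add: poly_ring_simps add_ac)
  show "monoid poly_ring"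
    by (rule monoidI) (simp_all add: poly_ring_simps mult_ac)
qed (simp_all add: poly_ring_simps algebra_simps)

lemma a_minus_poly_ring: "p \<ominus>\<^bsub>poly_ring\<^esub> q = p - q"
proof -
  interpret ring poly_ring by (rule ring_poly_ring)
  have "\<ominus>\<^bsub>poly_ring\<^esub> q = - q"
    by (rule minus_equality) (simp_all add: poly_ring_simps)
  then show ?thesis by (simp add: a_minus_def poly_ring_simps)
qed

lemma hom_poly_ring_finsum:
  assumes "ring R" "h \<in> Ring.ring_hom R poly_ring" "finite S" "f \<in> S \<rightarrow> carrier R"
  shows "h (\<Oplus>\<^bsub>R\<^esub>x\<in>S. f x) = (\<Sum>x\<in>S. h (f x))"
proof -
  interpret ring_hom_ring R poly_ring h
    using assms ring_poly_ring by (intro ring_hom_ringI2)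
  show ?thesis
    using assms(3,4)
  proof (induction S)
    case empty
    then show ?case using hom_zero by (simp add: poly_ring_simps)
  next
    case (insert x S)
    then have "h (f x \<oplus>\<^bsub>R\<^esub> (\<Oplus>\<^bsub>R\<^esub>x\<in>S. f x)) = h (f x) + h (\<Oplus>\<^bsub>R\<^esub>x\<in>S. f x)"
      by (subst hom_add) (auto simp: poly_ring_simps)
    then show ?case using insert by (simp add: R.finsum_insert Pi_iff)
  qed
qed

lemma hom_poly_ring_foldr:
  assumes "ring R" "h \<in> Ring.ring_hom R poly_ring" "\<And>i. i \<in> set xs \<Longrightarrow> f i \<in> carrier R"
    "\<And>i. i \<in> set xs \<Longrightarrow> h (f i) = [:0, c i:]"
  shows "foldr (\<lambda>i r. f i \<otimes>\<^bsub>R\<^esub> r) xs \<one>\<^bsub>R\<^esub> \<in> carrier R \<and>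
         h (foldr (\<lambda>i r. f i \<otimes>\<^bsub>R\<^esub> r) xs \<one>\<^bsub>R\<^esub>) = monom (prod_list (map c xs)) (length xs)"
proof -
  interpret ring_hom_ring R poly_ring h
    using assms ring_poly_ring by (intro ring_hom_ringI2)
  show ?thesis
    using assms(3,4)
  proof (induction xs)
    case Nil
    have "h \<one>\<^bsub>R\<^esub> = 1" using hom_one unfolding poly_ring_simps .
    then show ?case by (simp add: monom_eq_1)
  next
    case (Cons x xs)
    let ?F = "foldr (\<lambda>i r. f i \<otimes>\<^bsub>R\<^esub> r) xs \<one>\<^bsub>R\<^esub>"
    have IH: "?F \<in> carrier R" "h ?F = monom (prod_list (map c xs)) (length xs)"
      using Cons by auto
    have fx: "f x \<in> carrier R" "h (f x) = monom (c x) 1"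
      using Cons.prems(1) [of x] Cons.prems(2) [of x] by (simp_all add: monom_Suc monom_0)
    have "h (f x \<otimes>\<^bsub>R\<^esub> ?F) = monom (c x) 1 * monom (prod_list (map c xs)) (length xs)"
      using hom_mult [OF fx(1) IH(1)] unfolding poly_ring_simps fx(2) IH(2) .
    also have "\<dots> = monom (prod_list (map c (x # xs))) (length (x # xs))"
      unfolding mult_monom by simp
    finally show ?case using fx(1) IH(1) by simp
  qed
qed

text \<open>The inverse isomorphism is stated with \<open>inv_into\<close>, the values with
  \<open>the_inv_into\<close>; the two agree on the carrier.\<close>

lemma circle_identification_inverse_hom:
  assumes "circle_identification n \<iota>"
  shows "the_inv_into UNIV \<iota> \<in> Ring.ring_hom (H_pt n (circle n)) poly_ring"
    and "the_inv_into UNIV \<iota> (\<iota> P) = P"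
proof -
  have iso: "\<iota> \<in> ring_iso poly_ring (H_pt n (circle n))"
    using assms by (simp add: circle_identification_def)
  then have inj: "inj \<iota>" and surj: "\<iota> ` UNIV = carrier (H_pt n (circle n))"
    unfolding ring_iso_def bij_betw_def poly_ring_simps by auto
  interpret H: ring "H_pt n (circle n)" by (rule ring_cohomology)
  let ?j = "inv_into (carrier poly_ring) \<iota>"
  have j: "?j \<in> Ring.ring_hom (H_pt n (circle n)) poly_ring"
    using ring_iso_set_sym [OF ring_poly_ring iso] unfolding ring_iso_def by blast
  have eq: "the_inv_into UNIV \<iota> C = ?j C" if C: "C \<in> carrier (H_pt n (circle n))" for C
  proof -
    obtain P where "C = \<iota> P" using C surj by blast
    then show ?thesis using inj by (simp add: the_inv_into_f_f poly_ring_simps)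
  qed
  show "the_inv_into UNIV \<iota> \<in> Ring.ring_hom (H_pt n (circle n)) poly_ring"
    by (rule ring_hom_memI)
       (simp_all only: eq H.m_closed H.a_closed H.one_closed ring_hom_closed [OF j] ring_hom_mult [OF j]
         ring_hom_add [OF j] ring_hom_one [OF j])
  show "the_inv_into UNIV \<iota> (\<iota> P) = P"
    using inj by (simp add: the_inv_into_f_f)
qed

section \<open>Billey's formula over the circle\<close>

definition subwords :: "nat \<Rightarrow> nat list \<Rightarrow> (nat \<Rightarrow> nat) \<Rightarrow> nat set set" where
  "subwords n bs v = {I. I \<subseteq> {..<length bs} \<and> card I = cox_length n v \<and> word_prod (nths bs I) = v}"

lemma finite_subwords: "finite (subwords n bs v)"
  by (rule finite_subset [of _ "Pow {..<length bs}"]) (auto simp: subwords_def)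

locale peterson_setup =
  fixes n :: nat
    and t :: "nat \<Rightarrow> pt_class"
    and \<iota> :: "complex poly \<Rightarrow> pt_class"
    and \<sigma> :: "(nat \<Rightarrow> nat) \<Rightarrow> flag_class"
  assumes t: "\<And>k. k \<in> {1..n} \<Longrightarrow> chern_class n (torus n) (\<lambda>d. d $$ (k - 1, k - 1)) (t k)"
    and \<iota>: "circle_identification n \<iota>"
    and \<sigma>: "\<And>v. v permutes {1..n} \<Longrightarrow> schubert_class n t v (\<sigma> v)"
begin

definition specialize :: "pt_class \<Rightarrow> complex poly" where
  "specialize C = the_inv_into UNIV \<iota> (pullback (B_pt n (circle n)) (circle_to_torus n) C)"

lemma specialize_hom: "specialize \<in> Ring.ring_hom (H_pt n (torus n)) poly_ring"
  using ring_hom_trans [OF pullback_ring_hom [OF continuous_circle_to_torus] circle_identification_inverse_hom(1) [OF \<iota>]]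
  by (simp add: specialize_def [abs_def] o_def)

lemma specialize_t: "k \<in> {1..n} \<Longrightarrow> specialize (t k) = [:0, of_nat (n + 1 - k):]"
  unfolding specialize_def
  using circle_identification_chern_class [OF \<iota> _ chern_class_circle_to_torus [OF t]]
    circle_identification_inverse_hom(2) [OF \<iota>] by metis

text \<open>The summands \<open>n + 1\<close> cancel, leaving \<open>?u (?b + 1) - ?u ?b\<close>,
  the height of the root. It is positive by \<open>reduced_word_ascent\<close>.\<close>

lemma specialize_root_factor:
  assumes bs: "reduced_word n w bs" and i: "i < length bs"
  shows "root_factor (H_pt n (torus n)) t bs i \<in> carrier (H_pt n (torus n))"
    and "\<exists>c>0. specialize (root_factor (H_pt n (torus n)) t bs i) = [:0, of_nat c:]"
proof -
  let ?R = "H_pt n (torus n)"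
  interpret ring_hom_ring ?R poly_ring specialize
    by (rule ring_hom_ringI2 [OF ring_cohomology ring_poly_ring specialize_hom])
  let ?u = "word_prod (take i bs)" and ?b = "bs ! i"
  have set: "set bs \<subseteq> {1..n - 1}" using bs by (simp add: reduced_word_def)
  then have b: "?b \<in> {1..n - 1}" using i nth_mem by blast
  have u: "?u permutes {1..n}"
    using set set_take_subset [of i bs] by (intro word_prod_permutes) auto
  have mem: "?u ?b \<in> {1..n}" "?u (?b + 1) \<in> {1..n}"
    unfolding permutes_in_image [OF u] using b by auto
  have asc: "?u ?b < ?u (?b + 1)" using reduced_word_ascent [OF bs i] by simp
  have carr: "t (?u ?b) \<in> carrier ?R" "t (?u (?b + 1)) \<in> carrier ?R"
    using mem t chern_class_carrier by blast+
  then show "root_factor ?R t bs i \<in> carrier ?R"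
    unfolding root_factor_def by (rule R.minus_closed)
  have "specialize (root_factor ?R t bs i) = specialize (t (?u ?b)) - specialize (t (?u (?b + 1)))"
    unfolding root_factor_def a_minus_poly_ring [symmetric] unfolding a_minus_def
    by (simp only: hom_add hom_a_inv R.a_inv_closed carr)
  also have "\<dots> = [:0, of_nat (n + 1 - ?u ?b) - of_nat (n + 1 - ?u (?b + 1)):]"
    unfolding specialize_t [OF mem(1)] specialize_t [OF mem(2)] by simp
  also have "of_nat (n + 1 - ?u ?b) - of_nat (n + 1 - ?u (?b + 1)) = (of_nat (?u (?b + 1) - ?u ?b) :: complex)"
    using mem asc by (simp add: of_nat_diff)
  finally show "\<exists>c>0. specialize (root_factor ?R t bs i) = [:0, of_nat c:]"
    using asc by (intro exI [of _ "?u (?b + 1) - ?u ?b"]) simp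
qed

text \<open>No cancellation can occur among products of positive multiples of the variable, so the
  sum vanishes only if it is empty. Taking \<open>N\<close> to be a natural number records this
  positivity.\<close>

lemma specialize_billey_sum:
  assumes bs: "reduced_word n w bs"
  obtains N where "specialize (billey_sum n (H_pt n (torus n)) t bs v) = monom (of_nat N) (cox_length n v)"
    "N = 0 \<longleftrightarrow> subwords n bs v = {}"
proof -
  let ?R = "H_pt n (torus n)"
  define c where "c i = (SOME c. c > 0 \<and> specialize (root_factor ?R t bs i) = [:0, of_nat c:])" for i
  have c: "c i > 0 \<and> specialize (root_factor ?R t bs i) = [:0, of_nat (c i):]" if "i < length bs" for i
    unfolding c_def by (rule someI_ex) (use specialize_root_factor(2) [OF bs that] in blast)
  let ?N = "\<lambda>I. prod_list (map c (sorted_list_of_set I))"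
  let ?f = "\<lambda>I. foldr (\<lambda>i r. root_factor ?R t bs i \<otimes>\<^bsub>?R\<^esub> r) (sorted_list_of_set I) \<one>\<^bsub>?R\<^esub>"
  have sub: "set (sorted_list_of_set I) \<subseteq> {..<length bs}" "length (sorted_list_of_set I) = cox_length n v"
    if "I \<in> subwords n bs v" for I
  proof -
    have "finite I" using that finite_subset [of I "{..<length bs}"] by (auto simp: subwords_def)
    then show "set (sorted_list_of_set I) \<subseteq> {..<length bs}" "length (sorted_list_of_set I) = cox_length n v"
      using that by (auto simp: subwords_def)
  qed
  have f: "?f I \<in> carrier ?R \<and> specialize (?f I) = monom (of_nat (?N I)) (cox_length n v)"
    if "I \<in> subwords n bs v" for I
  proof -
    have "prod_list (map (\<lambda>i. of_nat (c i) :: complex) xs) = of_nat (prod_list (map c xs))" for xs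
      by (induction xs) simp_all
    then show ?thesis
      using hom_poly_ring_foldr [OF ring_cohomology specialize_hom, of "sorted_list_of_set I" "root_factor ?R t bs" "\<lambda>i. of_nat (c i)"]
        sub [OF that] specialize_root_factor(1) [OF bs] c by (auto simp: subset_iff)
  qed
  have "specialize (billey_sum n ?R t bs v) = (\<Sum>I\<in>subwords n bs v. specialize (?f I))"
    unfolding billey_sum_def subwords_def [symmetric]
    by (rule hom_poly_ring_finsum [OF ring_cohomology specialize_hom finite_subwords]) (use f in auto)
  also have "\<dots> = monom (of_nat (\<Sum>I\<in>subwords n bs v. ?N I)) (cox_length n v)"
    using f by (simp add: monom_sum)
  finally have eq: "specialize (billey_sum n ?R t bs v) =
      monom (of_nat (\<Sum>I\<in>subwords n bs v. ?N I)) (cox_length n v)" .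
  have "prod_list (map c xs) > 0" if "\<forall>i\<in>set xs. c i > 0" for xs
    using that by (induction xs) auto
  then have "?N I \<noteq> 0" if "I \<in> subwords n bs v" for I
    using sub(1) [OF that] c by (metis lessThan_iff less_numeral_extra(3) subsetD)
  then have "(\<Sum>I\<in>subwords n bs v. ?N I) = 0 \<longleftrightarrow> subwords n bs v = {}"
    unfolding sum_eq_0_iff [OF finite_subwords] by blast
  with eq show ?thesis by (rule that)
qed

text \<open>The reduced word is left free, so that each application can choose one suited to its
  purpose: a word starting with \<open>v\<close>, or one with letters in \<open>A\<close>.\<close>

lemma peterson_value_monom:
  assumes A: "A \<subseteq> {1..n - 1}" and v: "v permutes {1..n}" and bs: "reduced_word n (w_long n A) bs"
  obtains N where "peterson_value n \<iota> \<sigma> v A = monom (of_nat N) (cox_length n v)"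
    "N = 0 \<longleftrightarrow> subwords n bs v = {}"
proof -
  have wl: "w_long n A permutes {1..n}" using w_long_props(1) [OF A] by (rule parabolic_permutes)
  have S: "\<sigma> v \<in> carrier (cohomology (borel_space n (torus n) left_act (flag_variety n)))"
    and loc: "localize n (torus n) (\<sigma> v) (w_long n A) = billey_sum n (H_pt n (torus n)) t bs v"
    using \<sigma> [OF v] wl bs unfolding schubert_class_def by blast+
  have "peterson_value n \<iota> \<sigma> v A = specialize (billey_sum n (H_pt n (torus n)) t bs v)"
    unfolding peterson_value_def specialize_def localize_peterson_class [where \<sigma> = \<sigma> and v = v, OF A S] loc ..
  then show ?thesis using specialize_billey_sum [OF bs, of v] that by metis
qed

lemma peterson_value_parabolic:
  assumes A: "A \<subseteq> {1..n - 1}" and v: "parabolic n A v"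
  obtains N where "peterson_value n \<iota> \<sigma> v A = monom (of_nat N) (cox_length n v)" "N \<noteq> 0"
proof -
  have pv: "v permutes {1..n}" using v by (rule parabolic_permutes)
  obtain as where as: "set as \<subseteq> A" "length as = cox_length n v" "word_prod as = v"
    using parabolic_ex_word [OF v A] cox_length_eq [OF pv] by metis
  obtain bs where bs: "set bs \<subseteq> A" "v \<circ> word_prod bs = w_long n A"
    "cox_length n (w_long n A) = cox_length n v + length bs"
    using parabolic_extend [OF A v] by blast
  have red: "reduced_word n (w_long n A) (as @ bs)"
    using as bs A by (auto simp: reduced_word_def word_prod_append)
  \<comment> \<open>The initial positions spell \<open>v\<close> itself, so the sum is not
    empty.\<close>
  have "{..<length as} \<in> subwords n (as @ bs) v"
    using as by (simp add: subwords_def)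
  then show ?thesis
    using peterson_value_monom [OF A pv red] that by (metis empty_iff)
qed

text \<open>A nonzero value provides a subword with product \<open>v\<close>, and \<open>B\<close>
  is its set of letters. Repeated letters only shrink \<open>B\<close>, whence the bound on its
  cardinality.\<close>

lemma peterson_value_support:
  assumes A: "A \<subseteq> {1..n - 1}" and v: "v permutes {1..n}" and nz: "peterson_value n \<iota> \<sigma> v A \<noteq> 0"
  obtains B where "B \<subseteq> A" "parabolic n B v" "card B \<le> cox_length n v"
proof -
  have par: "parabolic n A (w_long n A)" by (rule w_long_props(1) [OF A])
  obtain bs where bs: "set bs \<subseteq> A" "length bs = cox_length n (w_long n A)" "word_prod bs = w_long n A"
    using parabolic_ex_word [OF par A] cox_length_eq [OF parabolic_permutes [OF par]] by metis
  then have red: "reduced_word n (w_long n A) bs" using A by (auto simp: reduced_word_def)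
  obtain N where N: "peterson_value n \<iota> \<sigma> v A = monom (of_nat N) (cox_length n v)"
    "N = 0 \<longleftrightarrow> subwords n bs v = {}"
    using peterson_value_monom [OF A v red] by blast
  then obtain I where I: "I \<subseteq> {..<length bs}" "card I = cox_length n v" "word_prod (nths bs I) = v"
    using nz by (auto simp: subwords_def)
  let ?B = "set (nths bs I)"
  have "?B \<subseteq> A" using bs(1) set_nths_subset by fastforce
  moreover have "parabolic n ?B v"
    using parabolic_word [of "nths bs I" ?B n] I(3) A \<open>?B \<subseteq> A\<close> by auto
  moreover have "card ?B \<le> cox_length n v"
  proof -
    have "{i. i < length bs \<and> i \<in> I} = I" using I(1) by auto
    then show ?thesis using card_length [of "nths bs I"] I(2) by (simp add: length_nths)
  qed
  ultimately show ?thesis by (rule that)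
qed

end

lemma monom_dvd_monom:
  fixes a b :: "'a :: field"
  assumes "a \<noteq> 0" "i \<le> j" shows "monom a i dvd monom b j"
proof
  show "monom b j = monom a i * monom (b / a) (j - i)"
    using assms by (simp add: mult_monom)
qed

theorem proposition5p13:
  fixes n :: nat
    and t :: "nat \<Rightarrow> pt_class"
    and \<iota> :: "complex poly \<Rightarrow> pt_class"
    and \<sigma> :: "(nat \<Rightarrow> nat) \<Rightarrow> flag_class"
    and A :: "nat set"
    and w :: "nat \<Rightarrow> nat"
  assumes "n > 0"
    and "\<And>k. k \<in> {1..n} \<Longrightarrow> chern_class n (torus n) (\<lambda>d. d $$ (k - 1, k - 1)) (t k)"
    and "circle_identification n \<iota>"
    and "\<And>v. v permutes {1..n} \<Longrightarrow> schubert_class n t v (\<sigma> v)"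
    and "A \<subseteq> {1..n - 1}"
    and "w permutes {1..n}"
    and "\<And>B. B \<subseteq> {1..n - 1} \<Longrightarrow> \<not> bruhat_le n (w_long n A) (w_long n B) \<Longrightarrow>
              peterson_value n \<iota> \<sigma> w B = 0"
    and "peterson_value n \<iota> \<sigma> w A \<noteq> 0"
  shows "peterson_value n \<iota> \<sigma> (v_cox A) A dvd peterson_value n \<iota> \<sigma> w A"
proof -
  interpret peterson_setup n t \<iota> \<sigma>
    using assms(2-4) by unfold_locales
  note A = assms(5)
  have fin: "finite A" using A by (rule finite_subset) simp
  obtain B where B: "B \<subseteq> A" "parabolic n B w" "card B \<le> cox_length n w"
    using peterson_value_support [OF A assms(6,8)] by blast
  have "B = A"
  proof (rule ccontr)
    assume "B \<noteq> A"
    then have "\<not> bruhat_le n (w_long n A) (w_long n B)" using B(1) by (intro w_long_psubset [OF A]) auto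
    then have "peterson_value n \<iota> \<sigma> w B = 0" using B(1) A by (intro assms(7)) auto
    moreover obtain N where "peterson_value n \<iota> \<sigma> w B = monom (of_nat N) (cox_length n w)" "N \<noteq> 0"
      using peterson_value_parabolic [OF _ B(2)] B(1) A by blast
    ultimately show False by (simp add: monom_eq_0_iff)
  qed
  have word: "set (sorted_list_of_set A) \<subseteq> A" "length (sorted_list_of_set A) = card A"
    using fin by auto
  have "parabolic n A (v_cox A)"
    unfolding v_cox_def by (rule parabolic_word [OF word(1) A])
  then obtain M where M: "peterson_value n \<iota> \<sigma> (v_cox A) A = monom (of_nat M) (cox_length n (v_cox A))" "M \<noteq> 0"
    using peterson_value_parabolic [OF A] by blast
  have "cox_length n (v_cox A) \<le> card A"
    unfolding v_cox_def using cox_length_word [OF subset_trans [OF word(1) A]] word(2) by simp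
  also have "\<dots> \<le> cox_length n w" using B(3) \<open>B = A\<close> by simp
  finally have le: "cox_length n (v_cox A) \<le> cox_length n w" .
  obtain N where N: "peterson_value n \<iota> \<sigma> w A = monom (of_nat N) (cox_length n w)"
    using peterson_value_parabolic [OF A] B(2) \<open>B = A\<close> by blast
  show ?thesis
    unfolding M(1) N by (rule monom_dvd_monom) (use M(2) le in simp_all)
qed

end
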